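(* Let $H$ be an infinite dimensional separable Hilbert space and let $\pi_c:B(H)\to B(H)/\mathcal K$ be the quotient map. There exist $0<\epsilon_0<1$ and a sequence of triples of self-adjoint operators $T_{n,1},T_{n,2},T_{n,3}\in B(H)$ ($n\in\mathbb N$) with $\|T_{n,j}\|\le1$ for all $n$ and $1\le j\le3$ such that $$\lim_{n\to\infty}\|T_{n,i}T_{n,j}-T_{n,j}T_{n,i}\|=0\quad(1\le i,j\le3),\qquad \pi_c(T_{n,j})=1_{B(H)/\mathcal K}\quad(1\le j\le 3,\ n\in\mathbb N),$$ and $$\inf\Big\{\max_{1\le j\le3}\|T_{n,j}-S_{n,j}\|\Big\}\ge\epsilon_0,$$ where the infimum is taken over all $n\in\mathbb N$ and all triples $S_{n,1},S_{n,2},S_{n,3}$ of self-adjoint operators in $B(H)$ with $S_{n,i}S_{n,j}=S_{n,j}S_{n,i}$ for $1\le i,j\le3$.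
   Context: $\mathcal K$ denotes the ideal of compact operators in $B(H)$. *)

theory Defs
  imports "HOL-Analysis.Analysis" "HOL-Algebra.QuotRing"
begin

section \<open>Complex Hilbert spaces\<close>

text \<open>
  The norm, metric and topology are those of the underlying real normed space. The axiom
  \<open>cinner_self\<close> says that this norm is the one induced by the inner product; it includes
  positivity and definiteness of the inner product, which is linear in its first argument.
\<close>

class complex_inner = real_normed_vector +
  fixes scaleC :: "complex \<Rightarrow> 'a \<Rightarrow> 'a"  (infixr \<open>*\<^sub>C\<close> 75)
    and cinner :: "'a \<Rightarrow> 'a \<Rightarrow> complex"
  assumes scaleC_add_right: "a *\<^sub>C (x + y) = a *\<^sub>C x + a *\<^sub>C y"
    and scaleC_add_left: "(a + b) *\<^sub>C x = a *\<^sub>C x + b *\<^sub>C x"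
    and scaleC_scaleC: "a *\<^sub>C (b *\<^sub>C x) = (a * b) *\<^sub>C x"
    and scaleC_one: "1 *\<^sub>C x = x"
    and scaleR_scaleC: "r *\<^sub>R x = complex_of_real r *\<^sub>C x"
    and cinner_commute: "cinner x y = cnj (cinner y x)"
    and cinner_add_left: "cinner (x + y) z = cinner x z + cinner y z"
    and cinner_scaleC_left: "cinner (a *\<^sub>C x) y = a * cinner x y"
    and cinner_self: "cinner x x = complex_of_real ((norm x)\<^sup>2)"

class complex_hilbert_space = complex_inner + complete_space

lemma vector_space_scaleC: "vector_space (scaleC :: complex \<Rightarrow> 'a::complex_inner \<Rightarrow> 'a)"
  by unfold_locales (fact scaleC_add_right scaleC_add_left scaleC_scaleC scaleC_one)+

lemmas scaleC_zero_right [simp] = module.scale_zero_right [OF vector_space_scaleC [folded module_iff_vector_space]]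
  and scaleC_minus_right [simp] = module.scale_minus_right [OF vector_space_scaleC [folded module_iff_vector_space]]

text \<open>Dimension is the algebraic dimension over the complex numbers.\<close>

definition infinite_dimensional :: "'a::complex_inner itself \<Rightarrow> bool" where
  "infinite_dimensional _ \<longleftrightarrow> \<not> (\<exists>B::'a set. finite B \<and> module.span scaleC B = UNIV)"


section \<open>Bounded operators\<close>

text \<open>
  The type \<open>'a \<Rightarrow>\<^sub>L 'a\<close> consists of the bounded \<^emph>\<open>real\<close>-linear operators, so \<open>B(H)\<close> is its subset
  of complex-linear operators. The norm of \<open>'a \<Rightarrow>\<^sub>L 'a\<close> is the operator norm.
\<close>

definition bounded_ops :: "('a::complex_inner \<Rightarrow>\<^sub>L 'a) set" where
  "bounded_ops = {T. \<forall>c x. blinfun_apply T (c *\<^sub>C x) = c *\<^sub>C blinfun_apply T x}"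

definition compact_ops :: "('a::complex_inner \<Rightarrow>\<^sub>L 'a) set" where
  "compact_ops = {T \<in> bounded_ops. compact (closure (blinfun_apply T ` cball 0 1))}"

definition self_adjoint :: "('a::complex_inner \<Rightarrow>\<^sub>L 'a) \<Rightarrow> bool" where
  "self_adjoint T \<longleftrightarrow> T \<in> bounded_ops \<and>
     (\<forall>x y. cinner (blinfun_apply T x) y = cinner x (blinfun_apply T y))"


section \<open>The quotient by the compact operators\<close>

definition B_ring :: "('a::complex_inner \<Rightarrow>\<^sub>L 'a) ring" where
  "B_ring = \<lparr>carrier = bounded_ops, mult = (o\<^sub>L), one = id_blinfun, zero = 0, add = (+)\<rparr>"

definition calkin_algebra :: "('a::complex_inner \<Rightarrow>\<^sub>L 'a) set ring" where
  "calkin_algebra = B_ring Quot compact_ops"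

definition pi_c :: "('a::complex_inner \<Rightarrow>\<^sub>L 'a) \<Rightarrow> ('a \<Rightarrow>\<^sub>L 'a) set" where
  "pi_c T = compact_ops +>\<^bsub>B_ring\<^esub> T"

lemma ring_B_ring: "ring (B_ring :: ('a::complex_inner \<Rightarrow>\<^sub>L 'a) ring)"
proof (rule ringI)
  show "abelian_group (B_ring :: ('a \<Rightarrow>\<^sub>L 'a) ring)"
  proof (rule abelian_groupI)
    fix T :: "'a \<Rightarrow>\<^sub>L 'a" assume "T \<in> carrier B_ring"
    then show "\<exists>S\<in>carrier B_ring. S \<oplus>\<^bsub>B_ring\<^esub> T = \<zero>\<^bsub>B_ring\<^esub>"
      by (intro bexI[of _ "- T"]) (auto simp: B_ring_def bounded_ops_def uminus_blinfun.rep_eq)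
  qed (auto simp: B_ring_def bounded_ops_def plus_blinfun.rep_eq scaleC_add_right add_ac)
  show "Group.monoid (B_ring :: ('a \<Rightarrow>\<^sub>L 'a) ring)"
    by (rule monoidI) (auto simp: B_ring_def bounded_ops_def intro!: blinfun_eqI)
qed (auto simp: B_ring_def blinfun.add_left blinfun.add_right intro!: blinfun_eqI)

lemma ideal_compact_ops: "ideal compact_ops (B_ring :: ('a::complex_inner \<Rightarrow>\<^sub>L 'a) ring)"
proof -
  interpret R: ring "B_ring :: ('a \<Rightarrow>\<^sub>L 'a) ring" by (rule ring_B_ring)
  have carr: "carrier B_ring = (bounded_ops :: ('a \<Rightarrow>\<^sub>L 'a) set)"
    and ops: "S \<oplus>\<^bsub>B_ring\<^esub> T = S + T" "S \<otimes>\<^bsub>B_ring\<^esub> T = S o\<^sub>L T" "\<zero>\<^bsub>B_ring\<^esub> = (0 :: 'a \<Rightarrow>\<^sub>L 'a)"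
    for S T :: "'a \<Rightarrow>\<^sub>L 'a" by (simp_all add: B_ring_def)
  have compactI: "T \<in> compact_ops"
    if "T \<in> bounded_ops" "compact K" "blinfun_apply T ` cball 0 1 \<subseteq> K" for T :: "'a \<Rightarrow>\<^sub>L 'a" and K
    using that unfolding compact_ops_def
    by (metis (no_types, lifting) closed_Int_compact closed_closure closure_minimal compact_imp_closed
        inf.absorb1 mem_Collect_eq)
  have bdd: "S + T \<in> bounded_ops" "S o\<^sub>L T \<in> bounded_ops" "0 \<in> (bounded_ops :: ('a \<Rightarrow>\<^sub>L 'a) set)"
    if "S \<in> bounded_ops" "T \<in> bounded_ops" for S T :: "'a \<Rightarrow>\<^sub>L 'a"
    using R.a_closed[of S T] R.m_closed[of S T] R.zero_closed that by (simp_all add: carr ops)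
  have lmult: "S o\<^sub>L T \<in> compact_ops" if T: "T \<in> compact_ops" and S: "S \<in> bounded_ops" for S T :: "'a \<Rightarrow>\<^sub>L 'a"
  proof (rule compactI)
    show "S o\<^sub>L T \<in> bounded_ops" using T S bdd by (simp add: compact_ops_def)
    show "compact (blinfun_apply S ` closure (blinfun_apply T ` cball 0 1))"
      using T by (intro compact_continuous_image)
        (auto simp: compact_ops_def intro!: linear_continuous_on blinfun.bounded_linear_right)
    show "blinfun_apply (S o\<^sub>L T) ` cball 0 1 \<subseteq> blinfun_apply S ` closure (blinfun_apply T ` cball 0 1)"
      using closure_subset by fastforce
  qed
  have neg_mem: "- (id_blinfun :: 'a \<Rightarrow>\<^sub>L 'a) \<in> bounded_ops"
    by (simp add: bounded_ops_def uminus_blinfun.rep_eq)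
  show ?thesis
  proof (rule idealI)
    show "ring (B_ring :: ('a \<Rightarrow>\<^sub>L 'a) ring)" by (rule ring_B_ring)
    show "subgroup compact_ops (add_monoid (B_ring :: ('a \<Rightarrow>\<^sub>L 'a) ring))"
    proof (rule R.add.subgroupI)
      show "compact_ops \<subseteq> carrier (B_ring :: ('a \<Rightarrow>\<^sub>L 'a) ring)" by (auto simp: carr compact_ops_def)
      have "(0 :: 'a \<Rightarrow>\<^sub>L 'a) \<in> compact_ops"
        using R.zero_closed by (intro compactI[of _ "{0}"]) (auto simp: carr ops)
      then show "compact_ops \<noteq> ({} :: ('a \<Rightarrow>\<^sub>L 'a) set)" by blast
    next
      fix T :: "'a \<Rightarrow>\<^sub>L 'a" assume T: "T \<in> compact_ops"
      have "(- id_blinfun) o\<^sub>L T = - T" by (auto intro!: blinfun_eqI simp: blinfun.minus_left)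
      then have mem: "- T \<in> compact_ops" using lmult[OF T neg_mem] by simp
      have "\<ominus>\<^bsub>B_ring\<^esub> T = - T"
        using T mem by (intro R.minus_equality) (auto simp: carr ops compact_ops_def)
      then show "\<ominus>\<^bsub>B_ring\<^esub> T \<in> compact_ops" using mem by simp
    next
      fix S T :: "'a \<Rightarrow>\<^sub>L 'a" assume S: "S \<in> compact_ops" and T: "T \<in> compact_ops"
      let ?c = "\<lambda>T :: 'a \<Rightarrow>\<^sub>L 'a. closure (blinfun_apply T ` cball 0 1)"
      have "S + T \<in> compact_ops"
      proof (rule compactI)
        show "S + T \<in> bounded_ops" using S T bdd by (simp add: compact_ops_def)
        show "compact {x + y |x y. x \<in> ?c S \<and> y \<in> ?c T}"
          using S T by (intro compact_sums) (auto simp: compact_ops_def)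
        show "blinfun_apply (S + T) ` cball 0 1 \<subseteq> {x + y |x y. x \<in> ?c S \<and> y \<in> ?c T}"
          unfolding plus_blinfun.rep_eq
          using closure_subset[of "blinfun_apply S ` cball 0 1"]
            closure_subset[of "blinfun_apply T ` cball 0 1"] by blast
      qed
      then show "S \<oplus>\<^bsub>B_ring\<^esub> T \<in> compact_ops" by (simp add: ops)
    qed
  next
    fix S T :: "'a \<Rightarrow>\<^sub>L 'a" assume T: "T \<in> compact_ops" and S: "S \<in> carrier B_ring"
    show "S \<otimes>\<^bsub>B_ring\<^esub> T \<in> compact_ops" using lmult T S by (simp add: carr ops)
    have "T o\<^sub>L S \<in> compact_ops"
    proof (rule compactI)
      show "T o\<^sub>L S \<in> bounded_ops" using T S bdd by (simp add: compact_ops_def carr)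
      show "compact ((\<lambda>x. norm S *\<^sub>R x) ` closure (blinfun_apply T ` cball 0 1))"
        using T by (intro compact_scaling) (auto simp: compact_ops_def)
      show "blinfun_apply (T o\<^sub>L S) ` cball 0 1 \<subseteq> (\<lambda>x. norm S *\<^sub>R x) ` closure (blinfun_apply T ` cball 0 1)"
      proof clarify
        fix x :: 'a assume x: "x \<in> cball 0 1"
        have le: "norm (S x) \<le> norm S"
          using norm_blinfun[of S x] x mult_left_le[of "norm x" "norm S"] by simp
        define y where "y = inverse (norm S) *\<^sub>R S x"
        have "y \<in> cball 0 1"
          using le by (cases "norm S = 0") (auto simp: y_def field_simps)
        moreover have "norm S *\<^sub>R y = S x" using le by (cases "norm S = 0") (auto simp: y_def)
        then have "blinfun_apply (T o\<^sub>L S) x = norm S *\<^sub>R T y"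
          by (metis blinfun.scaleR_right blinfun_apply_blinfun_compose)
        ultimately show "blinfun_apply (T o\<^sub>L S) x \<in> (\<lambda>x. norm S *\<^sub>R x) ` closure (blinfun_apply T ` cball 0 1)"
          using closure_subset by blast
      qed
    qed
    then show "T \<otimes>\<^bsub>B_ring\<^esub> S \<in> compact_ops" by (simp add: ops)
  qed
qed

end

theory Submission
  imports Defs
begin

text \<open>
  The triple \<open>T\<close> is a discrete Bott projection on a span of \<open>L + 1\<close> orthonormal vectors: a
  weighted shift \<open>D = T1 - i T2\<close> and a diagonal operator \<open>T3\<close>, with weights varying slowly along
  the meridian of the unit sphere; on the orthogonal complement all three operators are the
  identity. The obstruction is an index of the form
  \<open>q(x, y) = (T3 x, x) - (T3 y, y) + 2 Re (D y, x)\<close> on \<open>H \<times> H\<close>.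

  For commuting \<open>S\<close> near \<open>T\<close>, the negative spectral subspace \<open>W\<close> of \<open>S3\<close> is finite dimensional,
  since \<open>S3\<close> is positive on a subspace of finite codimension, and it is invariant under
  \<open>S1\<close> and \<open>S2\<close>. Hence the form of \<open>S\<close> is nonpositive on the product of \<open>W\<close> and its
  complement, a space of index 0 relative to \<open>0 \<times> H\<close>. The form of \<open>T\<close> is at least
  \<open>1/2\<close> on a space of index 1 relative to \<open>H \<times> 0\<close>. A finite homogeneous linear system with one
  more unknown than equations shows that the two spaces intersect, so \<open>S\<close> is not close to \<open>T\<close>.
\<close>

section \<open>Orthonormal families\<close>

interpretation scaleC: vector_space "scaleC :: complex \<Rightarrow> 'a::complex_inner \<Rightarrow> 'a"
  by (fact vector_space_scaleC)

section \<open>Inner product arithmetic and the Cauchy-Schwarz inequality\<close>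

lemma cinner_add_right: "cinner x (y + z) = cinner x y + cinner (x::'a::complex_inner) z"
  by (metis cinner_add_left cinner_commute complex_cnj_add)

lemma cinner_scaleC_right: "cinner x (a *\<^sub>C y) = cnj a * cinner (x::'a::complex_inner) y"
  by (metis cinner_commute cinner_scaleC_left complex_cnj_mult)

lemma cinner_scaleR_left: "cinner (r *\<^sub>R x) y = of_real r * cinner (x::'a::complex_inner) y"
  by (simp add: scaleR_scaleC cinner_scaleC_left)

lemma cinner_scaleR_right: "cinner x (r *\<^sub>R y) = of_real r * cinner (x::'a::complex_inner) y"
  by (simp add: scaleR_scaleC cinner_scaleC_right)

lemma cinner_zero_left [simp]: "cinner 0 (y::'a::complex_inner) = 0"
  using cinner_scaleR_left[of 0 y y] by simp

lemma cinner_zero_right [simp]: "cinner (y::'a::complex_inner) 0 = 0"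
  using cinner_scaleR_right[of y 0 y] by simp

lemma cinner_minus_left: "cinner (- x) y = - cinner (x::'a::complex_inner) y"
  using cinner_scaleR_left[of "-1" x y] by simp

lemma cinner_minus_right: "cinner x (- y) = - cinner (x::'a::complex_inner) y"
  using cinner_scaleR_right[of x "-1" y] by simp

lemma cinner_diff_left: "cinner (x - y) z = cinner x z - cinner (y::'a::complex_inner) z"
  using cinner_add_left[of x "- y" z] by (simp add: cinner_minus_left)

lemma cinner_diff_right: "cinner x (y - z) = cinner x y - cinner (x::'a::complex_inner) z"
  using cinner_add_right[of x y "- z"] by (simp add: cinner_minus_right)

lemma cinner_sum_left: "cinner (\<Sum>i\<in>I. f i) y = (\<Sum>i\<in>I. cinner (f i) (y::'a::complex_inner))"
  by (induction I rule: infinite_finite_induct) (auto simp: cinner_add_left)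

lemma cinner_sum_right: "cinner y (\<Sum>i\<in>I. f i) = (\<Sum>i\<in>I. cinner (y::'a::complex_inner) (f i))"
  by (induction I rule: infinite_finite_induct) (auto simp: cinner_add_right)

lemmas cinner_linear = cinner_add_left cinner_add_right cinner_diff_left cinner_diff_right
  cinner_scaleC_left cinner_scaleC_right cinner_scaleR_left cinner_scaleR_right
  cinner_minus_left cinner_minus_right

lemma Re_cinner_commute: "Re (cinner x y) = Re (cinner (y::'a::complex_inner) x)"
  by (metis cinner_commute complex_cnj(1) complex.sel(1) complex.collapse)

lemma Re_cinner_self: "Re (cinner x x) = (norm (x::'a::complex_inner))\<^sup>2"
  by (simp add: cinner_self)

lemma norm_add_squared:
  "(norm (x + y))\<^sup>2 = (norm x)\<^sup>2 + (norm y)\<^sup>2 + 2 * Re (cinner (x::'a::complex_inner) y)"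
  using Re_cinner_commute[of y x]
  by (simp add: Re_cinner_self[symmetric] cinner_linear)

lemma norm_scaleC: "norm (c *\<^sub>C x) = cmod c * norm (x::'a::complex_inner)"
proof -
  have "complex_of_real ((norm (c *\<^sub>C x))\<^sup>2) = of_real ((cmod c * norm x)\<^sup>2)"
    unfolding cinner_self[symmetric]
    by (simp add: cinner_linear cinner_self[of x] power_mult_distrib complex_norm_square mult_ac
        del: of_real_power)
  then have "(norm (c *\<^sub>C x))\<^sup>2 = (cmod c * norm x)\<^sup>2"
    using of_real_eq_iff by blast
  then show ?thesis
    by (metis norm_ge_zero power2_eq_iff_nonneg zero_le_mult_iff)
qed

lemma norm_cinner_le: "cmod (cinner x y) \<le> norm x * norm (y::'a::complex_inner)"
proof (cases "y = 0")
  case False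
  define c where "c = cinner x y / of_real ((norm y)\<^sup>2)"
  have n: "norm y > 0" using False by simp
  have "0 \<le> (norm (x + (- c) *\<^sub>C y))\<^sup>2" by simp
  also have "\<dots> = (norm x)\<^sup>2 + (cmod c)\<^sup>2 * (norm y)\<^sup>2 - 2 * Re (cnj c * cinner x y)"
    unfolding norm_add_squared by (simp add: norm_scaleC power_mult_distrib cinner_linear)
  also have "cnj c * cinner x y = of_real ((cmod (cinner x y))\<^sup>2 / (norm y)\<^sup>2)"
    by (simp add: c_def complex_norm_square mult.commute del: of_real_power)
  also have "(cmod c)\<^sup>2 * (norm y)\<^sup>2 = (cmod (cinner x y))\<^sup>2 / (norm y)\<^sup>2"
    using n by (simp add: c_def norm_divide norm_power power_divide) (simp add: power2_eq_square power4_eq_xxxx)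
  finally have "(cmod (cinner x y))\<^sup>2 \<le> (norm x * norm y)\<^sup>2"
    using n by (simp add: field_simps power_mult_distrib)
  then show ?thesis by (rule power2_le_imp_le) simp
qed simp

section \<open>Finite orthonormal families and their projections\<close>

definition orthonormal_on :: "'i set \<Rightarrow> ('i \<Rightarrow> 'a::complex_inner) \<Rightarrow> bool" where
  "orthonormal_on I f \<longleftrightarrow> (\<forall>i\<in>I. \<forall>j\<in>I. cinner (f i) (f j) = (if i = j then 1 else 0))"

lemma cinner_sum_orthonormal:
  assumes "orthonormal_on I f" "finite J" "J \<subseteq> I" "i \<in> I"
  shows "cinner (\<Sum>j\<in>J. c j *\<^sub>C f j) (f i) = (if i \<in> J then c i else 0)"
proof -
  have "cinner (\<Sum>j\<in>J. c j *\<^sub>C f j) (f i) = (\<Sum>j\<in>J. if j = i then c j else 0)"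
    unfolding cinner_sum_left cinner_linear
    by (rule sum.cong) (use assms in \<open>auto simp: orthonormal_on_def subset_iff\<close>)
  then show ?thesis using assms(2) by simp
qed

lemma cinner_sums_orthonormal:
  assumes "orthonormal_on I f" "finite I"
  shows "cinner (\<Sum>j\<in>I. c j *\<^sub>C f j) (\<Sum>j\<in>I. b j *\<^sub>C f j) = (\<Sum>j\<in>I. c j * cnj (b j))"
  unfolding cinner_sum_right[of _ _ I] cinner_linear
  by (rule sum.cong) (use assms in \<open>auto simp: cinner_sum_orthonormal\<close>)

lemma norm_sum_orthonormal:
  assumes "orthonormal_on I f" "finite I"
  shows "(norm (\<Sum>j\<in>I. c j *\<^sub>C f j))\<^sup>2 = (\<Sum>j\<in>I. (cmod (c j))\<^sup>2)"
proof -
  have "complex_of_real ((norm (\<Sum>j\<in>I. c j *\<^sub>C f j))\<^sup>2) = of_real (\<Sum>j\<in>I. (cmod (c j))\<^sup>2)"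
    unfolding cinner_self[symmetric] cinner_sums_orthonormal[OF assms]
    by (simp add: complex_norm_square del: of_real_power)
  then show ?thesis using of_real_eq_iff by blast
qed

definition orthoproj :: "'i set \<Rightarrow> ('i \<Rightarrow> 'a::complex_inner) \<Rightarrow> 'a \<Rightarrow> 'a" where
  "orthoproj I f x = (\<Sum>i\<in>I. cinner x (f i) *\<^sub>C f i)"

lemma cinner_residual_orthoproj:
  assumes "orthonormal_on I f" "finite I" "i \<in> I"
  shows "cinner (x - orthoproj I f x) (f i) = 0"
  using cinner_sum_orthonormal[OF assms(1,2) order_refl assms(3)]
  by (simp add: orthoproj_def cinner_diff_left assms(3))

lemma norm_orthoproj_squared:
  assumes "orthonormal_on I f" "finite I"
  shows "(norm (orthoproj I f x))\<^sup>2 = (\<Sum>i\<in>I. (cmod (cinner x (f i)))\<^sup>2)"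
  unfolding orthoproj_def by (rule norm_sum_orthonormal[OF assms])

text \<open>Pythagoras with free coefficients: besides splitting the norm of \<open>x\<close>, it
  later gives the norm of a vector whose component in the span has been replaced by another
  one.\<close>

lemma norm_residual_add_squared:
  assumes "orthonormal_on I f" "finite I"
  shows "(norm (x - orthoproj I f x + (\<Sum>i\<in>I. c i *\<^sub>C f i)))\<^sup>2 =
    (norm (x - orthoproj I f x))\<^sup>2 + (norm (\<Sum>i\<in>I. c i *\<^sub>C f i))\<^sup>2"
  unfolding norm_add_squared cinner_sum_right cinner_scaleC_right
  using assms by (simp add: cinner_residual_orthoproj)

lemma norm_squared_orthoproj:
  assumes "orthonormal_on I f" "finite I"
  shows "(norm x)\<^sup>2 = (norm (x - orthoproj I f x))\<^sup>2 + (norm (orthoproj I f x))\<^sup>2"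
  using norm_residual_add_squared[OF assms, of x "\<lambda>i. cinner x (f i)"]
  by (simp add: orthoproj_def)

text \<open>The map \<open>s\<close> makes this cover weighted shifts as well as diagonal operators.\<close>

lemma norm_weighted_sum_le:
  assumes f: "orthonormal_on I f" and I: "finite I" "K \<subseteq> I"
    and s: "inj_on s K" "s ` K \<subseteq> I" and w: "\<And>k. k \<in> K \<Longrightarrow> cmod (w k) \<le> m" and m: "0 \<le> m"
  shows "norm (\<Sum>k\<in>K. (w k * cinner x (f k)) *\<^sub>C f (s k)) \<le> m * norm (orthoproj I f x)"
proof -
  have "orthonormal_on K (f \<circ> s)"
    using f s by (auto simp: orthonormal_on_def inj_on_def image_subset_iff)
  from norm_sum_orthonormal[OF this finite_subset[OF I(2,1)], of "\<lambda>k. w k * cinner x (f k)"]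
  have "(norm (\<Sum>k\<in>K. (w k * cinner x (f k)) *\<^sub>C f (s k)))\<^sup>2 = (\<Sum>k\<in>K. (cmod (w k))\<^sup>2 * (cmod (cinner x (f k)))\<^sup>2)"
    by (simp add: norm_mult power_mult_distrib)
  also have "\<dots> \<le> (\<Sum>k\<in>K. m\<^sup>2 * (cmod (cinner x (f k)))\<^sup>2)"
    by (intro sum_mono mult_right_mono power_mono w) auto
  also have "\<dots> \<le> (\<Sum>k\<in>I. m\<^sup>2 * (cmod (cinner x (f k)))\<^sup>2)"
    using I by (intro sum_mono2) auto
  also have "\<dots> = (m * norm (orthoproj I f x))\<^sup>2"
    using norm_orthoproj_squared[OF f I(1)] by (simp add: power_mult_distrib sum_distrib_left)
  finally show ?thesis by (rule power2_le_imp_le) (use m in simp)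
qed

lemma norm_orthoproj_le:
  assumes "orthonormal_on I f" "finite I"
  shows "norm (orthoproj I f x) \<le> norm x"
  by (rule power2_le_imp_le) (simp_all add: norm_squared_orthoproj[OF assms, of x])

lemma norm_residual_le:
  assumes "orthonormal_on I f" "finite I"
  shows "norm (x - orthoproj I f x) \<le> norm x"
  by (rule power2_le_imp_le) (simp_all add: norm_squared_orthoproj[OF assms, of x])

text \<open>A Gram-Schmidt step with the residual already formed. It also serves to append an
  eigenvector to an eigenbasis.\<close>

lemma residual_nonzero_normalized:
  fixes f :: "'i \<Rightarrow> 'a::complex_inner"
  assumes "y \<noteq> 0" and I: "finite I" and "\<And>i. i \<in> I \<Longrightarrow> cinner y (f i) = 0"
    and f: "orthonormal_on I f" and j: "j \<notin> I"
  shows "orthonormal_on (insert j I) (f(j := (1 / norm y) *\<^sub>R y))"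
proof -
  have "cinner (f i) y = 0" if "i \<in> I" for i
    using assms(3)[OF that] by (metis cinner_commute complex_cnj_zero)
  moreover have "cinner y y = of_real (norm y) * of_real (norm y)"
    by (simp add: cinner_self power2_eq_square)
  ultimately show ?thesis
    using assms by (auto simp: orthonormal_on_def cinner_linear)
qed

text \<open>A vector outside the span of the first \<open>n\<close> vectors leaves a nonzero
  residual, so Gram-Schmidt never stops.\<close>

lemma exists_orthonormal:
  assumes "infinite_dimensional TYPE('a::complex_inner)"
  shows "\<exists>f :: nat \<Rightarrow> 'a. orthonormal_on {..<n} f"
proof (induction n)
  case 0
  show ?case by (auto simp: orthonormal_on_def)
next
  case (Suc n)
  then obtain f :: "nat \<Rightarrow> 'a" where f: "orthonormal_on {..<n} f" by blast
  have "module.span scaleC (f ` {..<n}) \<noteq> UNIV"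
    using assms by (auto simp: infinite_dimensional_def)
  then obtain x where x: "x \<notin> scaleC.span (f ` {..<n})" by blast
  have "orthoproj {..<n} f x \<in> scaleC.span (f ` {..<n})"
    unfolding orthoproj_def by (intro scaleC.span_sum scaleC.span_scale scaleC.span_base) auto
  with x have "x - orthoproj {..<n} f x \<noteq> 0" by auto
  from residual_nonzero_normalized[OF this _ cinner_residual_orthoproj[OF f] f, of n]
  show ?case by (auto simp: lessThan_Suc)
qed


text \<open>Both dimension counts of the proof rest on this: it bounds the number of negative
  eigenvectors, and it makes two subspaces intersect. The induction is Gaussian elimination.\<close>

lemma homogeneous_system_nontrivial:
  fixes M :: "'i \<Rightarrow> 'j \<Rightarrow> 'k::field"
  assumes "finite I" "finite J" "card I < card J"
  shows "\<exists>a. (\<exists>j\<in>J. a j \<noteq> 0) \<and> (\<forall>i\<in>I. (\<Sum>j\<in>J. M i j * a j) = 0)"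
  using assms
proof (induction I arbitrary: J M rule: finite_induct)
  case empty
  then have "J \<noteq> {}" by auto
  then show ?case by (intro exI[of _ "\<lambda>_. 1"]) auto
next
  case (insert i I)
  show ?case
  proof (cases "\<forall>j\<in>J. M i j = 0")
    case True
    have "card I < card J" using insert by simp
    from insert.IH[OF insert.prems(1) this, of M] True show ?thesis by auto
  next
    case False
    then obtain p where p: "p \<in> J" "M i p \<noteq> 0" by blast
    define K where "K = J - {p}"
    have K: "finite K" "p \<notin> K" "J = insert p K" using insert.prems p by (auto simp: K_def)
    have "card I < card K" using insert K by simp
    \<comment> \<open>Row \<open>i\<close> is solved for the unknown \<open>p\<close>, which is
      substituted into the other rows; \<open>b\<close> below restores the value of that
      unknown.\<close>
    from insert.IH[OF K(1) this, of "\<lambda>k j. M k j - M k p * M i j / M i p"]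
    obtain a where a: "\<exists>j\<in>K. a j \<noteq> 0"
      "\<And>k. k \<in> I \<Longrightarrow> (\<Sum>j\<in>K. (M k j - M k p * M i j / M i p) * a j) = 0" by blast
    define b where "b = a(p := - (\<Sum>j\<in>K. M i j * a j) / M i p)"
    have b: "(\<Sum>j\<in>J. M k j * b j) = M k p * b p + (\<Sum>j\<in>K. M k j * a j)" for k
      using K by (auto simp: b_def intro!: sum.cong)
    have "(\<Sum>j\<in>J. M k j * b j) = 0" if "k \<in> I" for k
    proof -
      have "0 = (\<Sum>j\<in>K. M k j * a j) - (\<Sum>j\<in>K. M k p / M i p * (M i j * a j))"
        using a(2)[OF that] by (simp add: left_diff_distrib sum_subtractf mult.assoc)
      then show ?thesis unfolding b by (simp add: b_def sum_distrib_left sum_divide_distrib)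
    qed
    moreover have "(\<Sum>j\<in>J. M i j * b j) = 0" unfolding b using p by (simp add: b_def)
    moreover have "\<exists>j\<in>J. b j \<noteq> 0" using a(1) K(2,3) by (auto simp: b_def)
    ultimately show ?thesis by blast
  qed
qed

section \<open>Negative spectral subspaces\<close>

lemma bounded_bilinear_cinner: "bounded_bilinear (cinner :: 'a::complex_inner \<Rightarrow> 'a \<Rightarrow> complex)"
proof
  show "\<exists>K. \<forall>a b::'a. norm (cinner a b) \<le> norm a * norm b * K"
    by (intro exI[of _ 1]) (simp add: norm_cinner_le)
qed (auto simp: cinner_linear scaleR_conv_of_real)

lemmas tendsto_cinner = bounded_bilinear.tendsto[OF bounded_bilinear_cinner]

lemma bounded_linear_scaleC_left: "bounded_linear (\<lambda>c. c *\<^sub>C (x::'a::complex_inner))"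
  by (rule bounded_linear_intro[where K = "norm x"])
    (auto simp: scaleC_add_left scaleR_scaleC scaleR_conv_of_real norm_scaleC)

lemma bounded_linear_scaleC_right: "bounded_linear (\<lambda>x::'a::complex_inner. c *\<^sub>C x)"
  by (rule bounded_linear_intro[where K = "cmod c"])
    (auto simp: scaleC_add_right scaleR_scaleC norm_scaleC mult.commute)

text \<open>Bolzano-Weierstrass for one coordinate at a time, each time inside the subsequence found
  before.\<close>

lemma convergent_common_subseq:
  fixes g :: "'i \<Rightarrow> nat \<Rightarrow> complex"
  assumes "finite I" "\<And>i n. i \<in> I \<Longrightarrow> cmod (g i n) \<le> B"
  shows "\<exists>r. strict_mono (r :: nat \<Rightarrow> nat) \<and> (\<forall>i\<in>I. convergent (g i \<circ> r))"
  using assms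
proof (induction I rule: finite_induct)
  case empty
  show ?case by (intro exI[of _ id]) (auto simp: strict_mono_def)
next
  case (insert i I)
  then obtain r where r: "strict_mono r" "\<forall>i\<in>I. convergent (g i \<circ> r)" by blast
  have "\<forall>n. (g i \<circ> r) n \<in> cball 0 B" using insert.prems by (auto simp: dist_norm)
  then obtain l r' where r': "strict_mono r'" "(g i \<circ> r \<circ> r') \<longlonglongrightarrow> l"
    using compact_cball[of "0::complex" B] unfolding compact_def by metis
  have "convergent (g j \<circ> (r \<circ> r'))" if "j \<in> I" for j
    using convergent_subseq_convergent[OF _ r'(1)] r(2) that by (metis comp_assoc)
  moreover have "convergent (g i \<circ> (r \<circ> r'))"
    using r'(2) by (auto simp: convergent_def comp_assoc)
  ultimately show ?case
    using strict_mono_o[OF r(1) r'(1)] by blast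
qed

text \<open>
  A minimising sequence for the Rayleigh quotient converges: its coordinates along the finite
  family \<open>f\<close> do so after passing to a subsequence, and on the orthogonal complement of \<open>f\<close> the
  form \<open>X - l\<close> with \<open>l < 0\<close> the infimum is coercive.
\<close>

lemma negative_eigenvector:
  fixes X :: "'a::complex_hilbert_space \<Rightarrow>\<^sub>L 'a"
  assumes X: "self_adjoint X"
    and f: "orthonormal_on I f" "finite I"
    and pos: "\<And>x. (\<And>i. i \<in> I \<Longrightarrow> cinner x (f i) = 0) \<Longrightarrow> 0 \<le> Re (cinner (X x) x)"
    and V: "V = {x. \<forall>j\<in>J. cinner x (e j) = 0}"
    and inv: "\<And>x. x \<in> V \<Longrightarrow> X x \<in> V"
    and x0: "x0 \<in> V" "Re (cinner (X x0) x0) < 0"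
  obtains u l where "u \<in> V" "norm u = 1" "l < 0" "X u = l *\<^sub>R u"
proof -
  have V_diff: "x - y \<in> V" and V_add: "x + y \<in> V" if "x \<in> V" "y \<in> V" for x y
    using that by (auto simp: V cinner_linear)
  have V_scale: "r *\<^sub>R x \<in> V" if "x \<in> V" for x r
    using that by (auto simp: V cinner_linear)
  define \<rho> where "\<rho> x = Re (cinner (X x) x)" for x
  have abs_\<rho>: "\<bar>\<rho> x\<bar> \<le> norm X * (norm x)\<^sup>2" for x
  proof -
    have "\<bar>\<rho> x\<bar> \<le> norm (X x) * norm x"
      unfolding \<rho>_def using abs_Re_le_cmod norm_cinner_le order_trans by blast
    also have "\<dots> \<le> norm X * norm x * norm x"
      by (intro mult_right_mono norm_blinfun) auto
    finally show ?thesis by (simp add: power2_eq_square mult_ac)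
  qed
  have \<rho>_scale: "\<rho> (r *\<^sub>R x) = r\<^sup>2 * \<rho> x" for r x
    by (simp add: \<rho>_def blinfun.scaleR_right cinner_linear power2_eq_square)
  define l where "l = Inf (\<rho> ` {x \<in> V. norm x = 1})"
  have bdd: "bdd_below (\<rho> ` {x \<in> V. norm x = 1})"
  proof (rule bdd_belowI[of _ "- norm X"])
    show "- norm X \<le> y" if y: "y \<in> \<rho> ` {x \<in> V. norm x = 1}" for y
    proof -
      obtain x where "y = \<rho> x" "norm x = 1" using y by blast
      then show ?thesis using abs_\<rho>[of x] by simp
    qed
  qed
  have l_le: "l * (norm x)\<^sup>2 \<le> \<rho> x" if "x \<in> V" for x
  proof (cases "x = 0")
    case False
    have "(1 / norm x) *\<^sub>R x \<in> {x \<in> V. norm x = 1}"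
      using False V_scale that by auto
    then have "l \<le> \<rho> ((1 / norm x) *\<^sub>R x)"
      unfolding l_def by (intro cInf_lower bdd imageI)
    then show ?thesis using False unfolding \<rho>_scale by (simp add: field_simps)
  qed (simp add: \<rho>_def)
  have "x0 \<noteq> 0" using x0 by auto
  have "l * (norm x0)\<^sup>2 < 0" using l_le[OF x0(1)] x0(2) by (simp add: \<rho>_def)
  then have l: "l < 0" by (simp add: mult_less_0_iff)
  have nonempty: "\<rho> ` {x \<in> V. norm x = 1} \<noteq> {}"
    using \<open>x0 \<noteq> 0\<close> V_scale[OF x0(1), of "1 / norm x0"] by force
  \<comment> \<open>The form \<open>E\<close> of \<open>X - l\<close> is nonnegative on
    \<open>V\<close> and has infimum 0 on the unit sphere of \<open>V\<close>. An eigenvector for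
    \<open>l\<close> is obtained as a unit zero of \<open>E\<close>.\<close>
  define Y where "Y x = X x - l *\<^sub>R x" for x
  define E where "E x = Re (cinner (Y x) x)" for x
  have E: "E x = \<rho> x - l * (norm x)\<^sup>2" for x
    by (simp add: E_def Y_def \<rho>_def cinner_linear cinner_self)
  have E_nonneg: "0 \<le> E x" if "x \<in> V" for x
    using l_le[OF that] by (simp add: E)
  have sym: "Re (cinner (Y y) x) = Re (cinner (Y x) y)" for x y
  proof -
    have "cinner (X y) x = cinner y (X x)" using X by (simp add: self_adjoint_def)
    then show ?thesis
      using Re_cinner_commute[of y "X x"] Re_cinner_commute[of y x] by (simp add: Y_def cinner_linear)
  qed
  have Y_add: "Y (x + y) = Y x + Y y" and Y_scale: "Y (r *\<^sub>R x) = r *\<^sub>R Y x" for x y r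
    by (simp_all add: Y_def blinfun.add_right blinfun.scaleR_right algebra_simps)
  have E_add: "E (x + y) = E x + E y + 2 * Re (cinner (Y x) y)" for x y
    using sym[of x y] by (simp add: E_def Y_add cinner_linear)
  have E_scale: "E (r *\<^sub>R x) = r\<^sup>2 * E x" for x r
    by (simp add: E_def Y_scale cinner_linear power2_eq_square)
  \<comment> \<open>The parallelogram identity with the nonnegative term \<open>E (x + y)\<close>
    dropped: differences of almost minimising vectors have small \<open>E\<close>.\<close>
  have E_diff: "E (x - y) \<le> 2 * E x + 2 * E y" if "x \<in> V" "y \<in> V" for x y
    using E_add[of x y] E_add[of x "- y"] E_scale[of "-1" y] E_nonneg[OF V_add[OF that]]
    by (simp add: cinner_linear)
  define K where "K = norm X - l"
  have K: "K \<ge> 0" unfolding K_def using l norm_ge_zero[of X] by linarith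
  have norm_Y: "norm (Y x) \<le> K * norm x" for x
    using norm_triangle_ineq4[of "X x" "l *\<^sub>R x"] norm_blinfun[of X x] l
    by (simp add: Y_def K_def algebra_simps)
  \<comment> \<open>Write \<open>h = g + p\<close> with \<open>p\<close> the projection. Positivity
    of \<open>X\<close> on the complement controls \<open>g\<close>. The rest is linear in
    \<open>norm p\<close>: \<open>2 * K\<close> from \<open>E p\<close>, \<open>4 * K\<close> from
    the cross term and \<open>- 2 * l\<close> from the square of \<open>norm p\<close>. The bound 2
    on \<open>norm h\<close> fits differences of unit vectors.\<close>
  have coercive: "- l * (norm h)\<^sup>2 \<le> E h + (6 * K - 2 * l) * norm (orthoproj I f h)"
    if h: "norm h \<le> 2" for h
  proof -
    define p g where "p = orthoproj I f h" and "g = h - p"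
    have split: "(norm h)\<^sup>2 = (norm g)\<^sup>2 + (norm p)\<^sup>2"
      unfolding g_def p_def by (rule norm_squared_orthoproj[OF f])
    have p2: "norm p \<le> 2" and g2: "norm g \<le> 2"
      using norm_orthoproj_le[OF f, of h] norm_residual_le[OF f, of h] h by (auto simp: p_def g_def)
    have pp: "(norm p)\<^sup>2 \<le> 2 * norm p" using p2 by (simp add: power2_eq_square mult_right_mono)
    have "0 \<le> \<rho> g"
      unfolding \<rho>_def by (rule pos) (auto simp: g_def p_def cinner_residual_orthoproj[OF f])
    then have Eg: "- l * (norm g)\<^sup>2 \<le> E g" by (simp add: E)
    have "\<bar>Re (cinner (Y g) p)\<bar> \<le> norm (Y g) * norm p"
      using abs_Re_le_cmod norm_cinner_le order_trans by blast
    also have "\<dots> \<le> (K * 2) * norm p"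
      using norm_Y[of g] g2 K by (intro mult_right_mono order_trans[OF norm_Y] mult_left_mono) auto
    finally have 1: "\<bar>Re (cinner (Y g) p)\<bar> \<le> 2 * K * norm p" by simp
    have "\<bar>E p\<bar> \<le> norm (Y p) * norm p"
      unfolding E_def using abs_Re_le_cmod norm_cinner_le order_trans by blast
    also have "\<dots> \<le> (K * 2) * norm p"
      using p2 K by (intro mult_right_mono order_trans[OF norm_Y] mult_left_mono) auto
    finally have 2: "\<bar>E p\<bar> \<le> 2 * K * norm p" by simp
    have "E h = E g + E p + 2 * Re (cinner (Y g) p)"
      using E_add[of g p] by (simp add: g_def)
    moreover have "- l * (norm p)\<^sup>2 \<le> - l * (2 * norm p)"
      using pp l by (intro mult_left_mono) auto
    ultimately show ?thesis
      using Eg 1 2 by (simp add: split p_def[symmetric] algebra_simps)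
  qed
  have "\<exists>x. x \<in> V \<and> norm x = 1 \<and> E x < 1 / Suc n" for n
  proof -
    have "l < l + 1 / Suc n" by simp
    then obtain y where "y \<in> \<rho> ` {x \<in> V. norm x = 1}" "y < l + 1 / Suc n"
      unfolding l_def using cInf_lessD[OF nonempty] by blast
    then show ?thesis by (auto simp: E)
  qed
  then obtain x where x: "\<And>n. x n \<in> V" "\<And>n. norm (x n) = 1" "\<And>n. E (x n) < 1 / Suc n"
    by metis
  have "cmod (cinner (x n) (f i)) \<le> 1" if "i \<in> I" for i n
  proof -
    have "(norm (f i))\<^sup>2 = 1"
      using f(1) that by (simp add: Re_cinner_self[symmetric] orthonormal_on_def)
    then have "norm (f i) = 1" by (smt (verit) norm_ge_zero power2_eq_1_iff)
    then show ?thesis using norm_cinner_le[of "x n" "f i"] x(2) by simp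
  qed
  then have "\<exists>r. strict_mono r \<and> (\<forall>i\<in>I. convergent ((\<lambda>n. cinner (x n) (f i)) \<circ> r))"
    by (rule convergent_common_subseq[OF f(2)])
  then obtain r where r: "strict_mono r"
    "\<And>i. i \<in> I \<Longrightarrow> convergent ((\<lambda>n. cinner (x n) (f i)) \<circ> r)" by blast
  define y where "y = x \<circ> r"
  have y: "y n \<in> V" "norm (y n) = 1" "E (y n) < 1 / Suc n" for n
  proof -
    have "1 / real (Suc (r n)) \<le> 1 / real (Suc n)"
      using seq_suble[OF r(1), of n] by (simp add: frac_le)
    then show "y n \<in> V" "norm (y n) = 1" "E (y n) < 1 / Suc n"
      using x[of "r n"] by (auto simp: y_def)
  qed
  have "convergent (\<lambda>n. orthoproj I f (y n))"
  proof -
    have "\<forall>i\<in>I. \<exists>a. (\<lambda>n. cinner (y n) (f i)) \<longlonglongrightarrow> a"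
      using r(2) by (auto simp: convergent_def y_def comp_def)
    then obtain a where a: "\<And>i. i \<in> I \<Longrightarrow> (\<lambda>n. cinner (y n) (f i)) \<longlonglongrightarrow> a i" by metis
    have "(\<lambda>n. orthoproj I f (y n)) \<longlonglongrightarrow> (\<Sum>i\<in>I. a i *\<^sub>C f i)" unfolding orthoproj_def
      by (intro tendsto_sum bounded_linear.tendsto[OF bounded_linear_scaleC_left] a)
    then show ?thesis by (rule convergentI)
  qed
  then have Cp: "Cauchy (\<lambda>n. orthoproj I f (y n))" by (rule convergent_Cauchy)
  have "Cauchy y"
  proof (rule CauchyI)
    fix \<epsilon> :: real assume \<epsilon>: "0 < \<epsilon>"
    \<comment> \<open>Half of the allowance \<open>- l * \<epsilon>\<^sup>2\<close> goes to
      \<open>E h\<close>, the other half to the projection term of \<open>coercive\<close>.\<close>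
    define \<delta> where "\<delta> = - l * \<epsilon>\<^sup>2 / 2"
    define C where "C = 6 * K - 2 * l"
    have \<delta>: "\<delta> > 0" and C: "C > 0" using l \<epsilon> K by (auto simp: \<delta>_def C_def mult_neg_pos)
    then have "\<delta> / C > 0" by simp
    from CauchyD[OF Cp this] obtain M where M:
      "\<And>m n. M \<le> m \<Longrightarrow> M \<le> n \<Longrightarrow> norm (orthoproj I f (y m) - orthoproj I f (y n)) < \<delta> / C" by blast
    obtain N where N: "1 / real (Suc N) < \<delta> / 4"
      using nat_approx_posE[of "\<delta> / 4"] \<delta> by (auto simp del: of_nat_Suc)
    show "\<exists>M. \<forall>m\<ge>M. \<forall>n\<ge>M. norm (y m - y n) < \<epsilon>"
    proof (intro exI allI impI)
      fix m n assume mn: "max M N \<le> m" "max M N \<le> n"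
      define h where "h = y m - y n"
      have "orthoproj I f h = orthoproj I f (y m) - orthoproj I f (y n)"
        by (simp add: h_def orthoproj_def cinner_linear scaleC.scale_left_diff_distrib sum_subtractf)
      then have "norm (orthoproj I f h) < \<delta> / C" using M mn by simp
      then have 1: "C * norm (orthoproj I f h) < \<delta>" using C by (simp add: field_simps)
      have "1 / real (Suc m) \<le> 1 / real (Suc N)" "1 / real (Suc n) \<le> 1 / real (Suc N)"
        using mn by (auto simp: frac_le)
      then have 2: "E h < \<delta>"
        using E_diff[OF y(1) y(1), of m n] y(3)[of m] y(3)[of n] N unfolding h_def by linarith
      have "norm h \<le> 2" using norm_triangle_ineq4[of "y m" "y n"] y(2) by (simp add: h_def)
      from coercive[OF this] 1 2 have "- l * (norm h)\<^sup>2 < - l * \<epsilon>\<^sup>2"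
        by (simp add: C_def[symmetric] \<delta>_def)
      then show "norm (y m - y n) < \<epsilon>"
        using l \<epsilon> by (simp add: h_def power_less_imp_less_base)
    qed
  qed
  then obtain u where u: "y \<longlonglongrightarrow> u"
    using Cauchy_convergent convergent_def by blast
  have uV: "u \<in> V"
  proof -
    have "cinner u (e j) = 0" if "j \<in> J" for j
    proof -
      have "(\<lambda>n. cinner (y n) (e j)) \<longlonglongrightarrow> cinner u (e j)"
        by (intro tendsto_cinner u tendsto_const)
      moreover have "cinner (y n) (e j) = 0" for n using y(1) that by (simp add: V)
      ultimately show ?thesis by (simp add: LIMSEQ_const_iff)
    qed
    then show ?thesis by (simp add: V)
  qed
  have u1: "norm u = 1"
    using tendsto_norm[OF u] y(2) by (simp add: LIMSEQ_const_iff)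
  have "(\<lambda>n. E (y n)) \<longlonglongrightarrow> E u"
    unfolding E_def Y_def by (intro tendsto_Re tendsto_cinner tendsto_diff blinfun.tendsto tendsto_scaleR u tendsto_const)
  moreover have "(\<lambda>n. E (y n)) \<longlonglongrightarrow> 0"
  proof (rule tendsto_sandwich[of "\<lambda>_. 0"])
    show "\<forall>\<^sub>F n in sequentially. E (y n) \<le> 1 / Suc n" using y(3) by (simp add: less_imp_le)
    show "(\<lambda>n. 1 / real (Suc n)) \<longlonglongrightarrow> 0"
      using LIMSEQ_inverse_real_of_nat by (simp add: inverse_eq_divide)
  qed (use y(1) E_nonneg in auto)
  ultimately have Eu: "E u = 0" by (rule LIMSEQ_unique)
  have "Y u = 0"
  proof (rule ccontr)
    define z where "z = Y u"
    assume "Y u \<noteq> 0"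
    then have z0: "(norm z)\<^sup>2 > 0" by (simp add: z_def)
    have zV: "z \<in> V" using inv[OF uV] V_diff V_scale uV by (simp add: z_def Y_def)
    \<comment> \<open>Moving from \<open>u\<close> by \<open>- t * z\<close> changes
      \<open>E\<close> by \<open>- 2 * t * (norm z)\<^sup>2\<close> to first order. This
      \<open>t\<close> is so small that the quadratic term cannot compensate; the added 1 keeps the
      denominator positive when \<open>E z = 0\<close>.\<close>
    define t where "t = (norm z)\<^sup>2 / (E z + 1)"
    have t: "t > 0" "t * E z < (norm z)\<^sup>2"
      using z0 E_nonneg[OF zV] by (auto simp: t_def field_simps)
    have "0 \<le> E (u + (- t) *\<^sub>R z)" by (intro E_nonneg V_add V_scale uV zV)
    also have "\<dots> = t * (t * E z - 2 * (norm z)\<^sup>2)"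
      unfolding E_add E_scale Eu
      by (simp add: z_def[symmetric] cinner_linear cinner_self algebra_simps power2_eq_square)
    also have "\<dots> < 0" using t z0 by (intro mult_pos_neg) linarith+
    finally show False by simp
  qed
  then have "X u = l *\<^sub>R u" by (simp add: Y_def)
  with that uV u1 l show thesis by blast
qed

section \<open>Eigenbases of negative spectral subspaces\<close>

lemma bounded_opsD: "T \<in> bounded_ops \<Longrightarrow> T (c *\<^sub>C x) = c *\<^sub>C T x"
  by (simp add: bounded_ops_def)

lemma self_adjoint_bounded: "self_adjoint T \<Longrightarrow> T \<in> bounded_ops"
  by (simp add: self_adjoint_def)

lemma self_adjointD: "self_adjoint T \<Longrightarrow> cinner (T x) y = cinner x (T y)"
  by (simp add: self_adjoint_def)

lemma blinfun_sum_scaleC: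
  "T \<in> bounded_ops \<Longrightarrow> T (\<Sum>k\<in>K. c k *\<^sub>C f k) = (\<Sum>k\<in>K. c k *\<^sub>C T (f k))"
  by (simp add: blinfun.sum_right bounded_opsD)

text \<open>The span stands in for a negative spectral subspace. The length is a parameter so that a
  longest family can be chosen.\<close>

definition negative_eigenbasis :: "('a::complex_inner \<Rightarrow>\<^sub>L 'a) \<Rightarrow> nat \<Rightarrow> (nat \<Rightarrow> 'a) \<Rightarrow> bool" where
  "negative_eigenbasis X m e \<longleftrightarrow> orthonormal_on {..<m} e \<and> (\<forall>k<m. \<exists>l<0. X (e k) = l *\<^sub>R e k)"

lemma negative_eigenbasis_form_nonpos:
  assumes "X \<in> bounded_ops" and e: "negative_eigenbasis X m e"
  shows "Re (cinner (X (\<Sum>k<m. a k *\<^sub>C e k)) (\<Sum>k<m. a k *\<^sub>C e k)) \<le> 0"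
proof -
  from e obtain l where l: "\<And>k. k < m \<Longrightarrow> l k < 0 \<and> X (e k) = l k *\<^sub>R e k"
    unfolding negative_eigenbasis_def by metis
  have "X (\<Sum>k<m. a k *\<^sub>C e k) = (\<Sum>k<m. (a k * of_real (l k)) *\<^sub>C e k)"
    using assms(1) l by (simp add: blinfun_sum_scaleC scaleR_scaleC)
  then have "cinner (X (\<Sum>k<m. a k *\<^sub>C e k)) (\<Sum>k<m. a k *\<^sub>C e k) = (\<Sum>k<m. of_real (l k * (cmod (a k))\<^sup>2))"
    using e by (simp add: cinner_sums_orthonormal negative_eigenbasis_def complex_norm_square mult_ac
        del: of_real_power)
  moreover have "(\<Sum>k<m. l k * (cmod (a k))\<^sup>2) \<le> 0"
    using l by (intro sum_nonpos mult_nonpos_nonneg) (auto simp: less_imp_le)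
  ultimately show ?thesis by simp
qed

text \<open>A longest family works. Lengths are bounded by \<open>card I\<close>, because a larger
  span would contain a nonzero vector orthogonal to \<open>f\<close>, where the form is positive. If
  the form were negative somewhere on the complement, \<open>negative_eigenvector\<close> would
  extend the longest family.\<close>

lemma exists_complete_negative_eigenbasis:
  fixes X :: "'a::complex_hilbert_space \<Rightarrow>\<^sub>L 'a"
  assumes X: "self_adjoint X"
    and f: "orthonormal_on I f" "finite I"
    and pos: "\<And>x. (\<And>i. i \<in> I \<Longrightarrow> cinner x (f i) = 0) \<Longrightarrow> x \<noteq> 0 \<Longrightarrow> 0 < Re (cinner (X x) x)"
  obtains m e where "negative_eigenbasis X m e"
    "\<And>x. (\<And>k. k < m \<Longrightarrow> cinner x (e k) = 0) \<Longrightarrow> 0 \<le> Re (cinner (X x) x)"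
proof -
  let ?P = "\<lambda>m. \<exists>e. negative_eigenbasis X m e"
  have bound: "m \<le> card I" if "?P m" for m
  proof (rule ccontr)
    assume "\<not> m \<le> card I"
    then have "card I < card {..<m}" by simp
    from homogeneous_system_nontrivial[OF f(2) _ this]
    have sys: "\<exists>a. (\<exists>k<m. a k \<noteq> 0) \<and> (\<forall>i\<in>I. (\<Sum>k<m. M i k * a k) = 0)"
      for M :: "'b \<Rightarrow> nat \<Rightarrow> complex" by (simp add: Bex_def)
    from that obtain e where e: "negative_eigenbasis X m e" by blast
    then have orth: "orthonormal_on {..<m} e" by (simp add: negative_eigenbasis_def)
    from sys[of "\<lambda>i k. cinner (e k) (f i)"] obtain a k where
      a: "k < m" "a k \<noteq> 0" "\<And>i. i \<in> I \<Longrightarrow> (\<Sum>k<m. cinner (e k) (f i) * a k) = 0" by blast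
    define x where "x = (\<Sum>k<m. a k *\<^sub>C e k)"
    have "cinner x (e k) = a k"
      using cinner_sum_orthonormal[OF orth, of "{..<m}" k a] a(1) by (simp add: x_def)
    then have "x \<noteq> 0" using a(2) by auto
    moreover have "cinner x (f i) = 0" if "i \<in> I" for i
      using a(3)[OF that] by (simp add: x_def cinner_sum_left cinner_scaleC_left mult.commute)
    ultimately show False
      using pos[of x] negative_eigenbasis_form_nonpos[OF self_adjoint_bounded[OF X] e, of a]
      by (force simp: x_def)
  qed
  have "?P 0" by (simp add: negative_eigenbasis_def orthonormal_on_def)
  then have "?P (Greatest ?P)" by (rule GreatestI_nat) (rule bound)
  moreover define m where "m = Greatest ?P"
  ultimately obtain e where e: "negative_eigenbasis X m e" by auto
  have max: "k \<le> m" if "?P k" for k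
    unfolding m_def using that by (rule Greatest_le_nat) (rule bound)
  from e obtain l where l: "\<And>k. k < m \<Longrightarrow> X (e k) = l k *\<^sub>R e k"
    unfolding negative_eigenbasis_def by metis
  have "0 \<le> Re (cinner (X x0) x0)" if x0: "\<And>k. k < m \<Longrightarrow> cinner x0 (e k) = 0" for x0
  proof (rule ccontr)
    assume neg: "\<not> 0 \<le> Re (cinner (X x0) x0)"
    define V where "V = {x. \<forall>k\<in>{..<m}. cinner x (e k) = 0}"
    have inv: "X x \<in> V" if "x \<in> V" for x
      using that by (simp add: V_def self_adjointD[OF X] l cinner_linear)
    have pos': "0 \<le> Re (cinner (X x) x)" if "\<And>i. i \<in> I \<Longrightarrow> cinner x (f i) = 0" for x
      using pos[OF that] by (cases "x = 0") (auto simp: less_imp_le)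
    have "x0 \<in> V" "Re (cinner (X x0) x0) < 0" using x0 neg by (auto simp: V_def)
    from negative_eigenvector[OF X f pos' V_def inv this]
    obtain u c where u: "u \<in> V" "norm u = 1" "c < 0" "X u = c *\<^sub>R u" by blast
    have "u \<noteq> 0" using u(2) by auto
    from residual_nonzero_normalized[OF this, of "{..<m}" e m] u e
    have "orthonormal_on {..<Suc m} (e(m := u))"
      by (simp add: lessThan_Suc V_def negative_eigenbasis_def)
    then have "negative_eigenbasis X (Suc m) (e(m := u))"
      using u e by (auto simp: negative_eigenbasis_def less_Suc_eq)
    then show False using max[of "Suc m"] by auto
  qed
  with that e show thesis by blast
qed

text \<open>\<open>Z\<close> maps each \<open>e k\<close> to a vector satisfying the same eigenvalue
  equation. The part of it orthogonal to the family satisfies that equation too, with a negative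
  eigenvalue, and so vanishes by \<open>nonneg\<close>. Hence \<open>Z\<close> preserves the span
  and, being self-adjoint, the complement.\<close>

lemma commutant_preserves_complement:
  assumes X: "self_adjoint X" and Z: "self_adjoint Z" and comm: "Z o\<^sub>L X = X o\<^sub>L Z"
    and e: "negative_eigenbasis X m e"
    and nonneg: "\<And>x. (\<And>k. k < m \<Longrightarrow> cinner x (e k) = 0) \<Longrightarrow> 0 \<le> Re (cinner (X x) x)"
    and x: "\<And>k. k < m \<Longrightarrow> cinner x (e k) = 0" and k: "k < m"
  shows "cinner (Z x) (e k) = 0"
proof -
  from e have orth: "orthonormal_on {..<m} e" by (simp add: negative_eigenbasis_def)
  from e obtain l where l: "\<And>k. k < m \<Longrightarrow> l k < 0 \<and> X (e k) = l k *\<^sub>R e k"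
    unfolding negative_eigenbasis_def by metis
  define v where "v = Z (e k)"
  have Xv: "X v = l k *\<^sub>R v"
    using fun_cong[OF arg_cong[OF comm, of blinfun_apply], of "e k"] l[OF k]
    by (simp add: v_def blinfun.scaleR_right)
  \<comment> \<open>Eigenvectors for distinct eigenvalues are orthogonal: \<open>v\<close> has
    components only along those \<open>e j\<close> with \<open>l j = l k\<close>.\<close>
  have coeff: "cinner v (e j) * of_real (l j) = of_real (l k) * cinner v (e j)" if "j < m" for j
    using self_adjointD[OF X, of v "e j"] l[OF that] by (auto simp: Xv cinner_linear)
  define y where "y = v - orthoproj {..<m} e v"
  have "X (orthoproj {..<m} e v) = l k *\<^sub>R orthoproj {..<m} e v"
  proof -
    have "X (orthoproj {..<m} e v) = (\<Sum>j<m. (cinner v (e j) * of_real (l j)) *\<^sub>C e j)"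
      using l by (simp add: orthoproj_def blinfun_sum_scaleC[OF self_adjoint_bounded[OF X]] scaleR_scaleC)
    also have "\<dots> = (\<Sum>j<m. (of_real (l k) * cinner v (e j)) *\<^sub>C e j)"
      by (rule sum.cong) (simp_all only: coeff lessThan_iff)
    finally show ?thesis by (simp add: orthoproj_def scaleR_scaleC scaleC.scale_sum_right)
  qed
  then have Xy: "X y = l k *\<^sub>R y"
    by (simp add: y_def blinfun.diff_right Xv scaleR_diff_right)
  have "0 \<le> Re (cinner (X y) y)"
    by (rule nonneg) (simp add: y_def cinner_residual_orthoproj[OF orth])
  then have "0 \<le> l k * (norm y)\<^sup>2" by (simp add: Xy cinner_linear Re_cinner_self)
  then have "y = 0" using l[OF k] by (simp add: zero_le_mult_iff)
  then have "v = orthoproj {..<m} e v" by (simp add: y_def)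
  then have "cinner x v = cinner x (orthoproj {..<m} e v)" by simp
  also have "\<dots> = 0" unfolding orthoproj_def cinner_sum_right cinner_scaleC_right using x by simp
  finally show ?thesis by (simp add: v_def self_adjointD[OF Z])
qed

section \<open>The form of the Pauli combination\<close>

text \<open>
  The quadratic form at \<open>(x, y)\<close> of \<open>\<sigma>\<^sub>1 \<otimes> X1 + \<sigma>\<^sub>2 \<otimes> X2 + \<sigma>\<^sub>3 \<otimes> X3\<close>, where the \<open>\<sigma>\<^sub>j\<close> are the
  Pauli matrices.
\<close>

definition pauli_form ::
    "('a::complex_inner \<Rightarrow>\<^sub>L 'a) \<Rightarrow> ('a \<Rightarrow>\<^sub>L 'a) \<Rightarrow> ('a \<Rightarrow>\<^sub>L 'a) \<Rightarrow> 'a \<Rightarrow> 'a \<Rightarrow> real" where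
  "pauli_form X1 X2 X3 x y =
    Re (cinner (X3 x) x) - Re (cinner (X3 y) y) + 2 * Re (cinner (X1 y - \<i> *\<^sub>C X2 y) x)"

text \<open>\<open>S1\<close> and \<open>S2\<close> keep \<open>y\<close> in the complement of the
  eigenbasis while the first argument lies in its span, so the cross term vanishes and two terms
  with known signs remain.\<close>

lemma pauli_form_commuting_nonpos:
  assumes S: "self_adjoint S1" "self_adjoint S2" "self_adjoint S3"
    and comm: "S1 o\<^sub>L S3 = S3 o\<^sub>L S1" "S2 o\<^sub>L S3 = S3 o\<^sub>L S2"
    and e: "negative_eigenbasis S3 m e"
    and nonneg: "\<And>x. (\<And>k. k < m \<Longrightarrow> cinner x (e k) = 0) \<Longrightarrow> 0 \<le> Re (cinner (S3 x) x)"
    and y: "\<And>k. k < m \<Longrightarrow> cinner y (e k) = 0"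
  shows "pauli_form S1 S2 S3 (\<Sum>k<m. a k *\<^sub>C e k) y \<le> 0"
proof -
  have "cinner (S1 y) (e k) = 0" "cinner (S2 y) (e k) = 0" if "k < m" for k
    using commutant_preserves_complement[OF S(3) S(1) comm(1) e nonneg y that]
      commutant_preserves_complement[OF S(3) S(2) comm(2) e nonneg y that] by auto
  then have "cinner (S1 y - \<i> *\<^sub>C S2 y) (\<Sum>k<m. a k *\<^sub>C e k) = 0"
    by (simp add: cinner_sum_right cinner_linear)
  then show ?thesis
    using nonneg[OF y] negative_eigenbasis_form_nonpos[OF self_adjoint_bounded[OF S(3)] e, of a]
    by (simp add: pauli_form_def)
qed

lemma Re_cinner_blinfun_le:
  assumes "norm (A :: 'a::complex_inner \<Rightarrow>\<^sub>L 'a) \<le> \<epsilon>"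
  shows "\<bar>Re (cinner (A x) y)\<bar> \<le> \<epsilon> * norm x * norm y"
proof -
  have "\<bar>Re (cinner (A x) y)\<bar> \<le> norm (A x) * norm y"
    using abs_Re_le_cmod norm_cinner_le order_trans by blast
  also have "\<dots> \<le> (\<epsilon> * norm x) * norm y"
    using norm_blinfun[of A x] mult_right_mono[OF assms, of "norm x"] by (intro mult_right_mono) auto
  finally show ?thesis .
qed

text \<open>The factor 3 counts one share for \<open>T3\<close> and one for each of the two cross
  terms, by the inequality of arithmetic and geometric means.\<close>

lemma pauli_form_perturb:
  assumes "norm (T1 - S1) \<le> \<epsilon>" "norm (T2 - S2) \<le> \<epsilon>" "norm (T3 - S3) \<le> \<epsilon>"
  shows "pauli_form T1 T2 T3 x y \<le> pauli_form S1 S2 S3 x y + 3 * \<epsilon> * ((norm x)\<^sup>2 + (norm y)\<^sup>2)"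
proof -
  have \<epsilon>: "0 \<le> \<epsilon>" using assms(1) norm_ge_zero order_trans by blast
  \<comment> \<open>The factor \<open>\<i>\<close> moves to the second argument, which keeps its
    norm, so that one estimate covers all four errors.\<close>
  have "pauli_form T1 T2 T3 x y = pauli_form S1 S2 S3 x y
    + Re (cinner ((T3 - S3) x) x) - Re (cinner ((T3 - S3) y) y)
    + 2 * (Re (cinner ((T1 - S1) y) x) - Re (cinner ((T2 - S2) y) (- \<i> *\<^sub>C x)))"
    by (simp add: pauli_form_def blinfun.diff_left cinner_linear algebra_simps)
  moreover have "norm (- \<i> *\<^sub>C x) = norm x" by (simp add: norm_scaleC)
  moreover have "2 * (\<epsilon> * norm y * norm x) \<le> \<epsilon> * ((norm x)\<^sup>2 + (norm y)\<^sup>2)"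
    using mult_left_mono[OF sum_squares_bound[of "norm x" "norm y"] \<epsilon>] by (simp add: mult_ac)
  ultimately show ?thesis
    using Re_cinner_blinfun_le[OF assms(1), of y x] Re_cinner_blinfun_le[OF assms(2), of y "- \<i> *\<^sub>C x"]
      Re_cinner_blinfun_le[OF assms(3), of x x] Re_cinner_blinfun_le[OF assms(3), of y y]
    by (simp add: power2_eq_square distrib_left mult_ac)
qed

section \<open>Finite-rank operators and the Calkin algebra\<close>

definition outer :: "'a::complex_inner \<Rightarrow> 'a \<Rightarrow> 'a \<Rightarrow>\<^sub>L 'a" where
  "outer a b = Blinfun (\<lambda>x. cinner x b *\<^sub>C a)"

lemma outer_apply [simp]: "outer a b x = cinner x b *\<^sub>C a"
  unfolding outer_def
  using bounded_linear_compose[OF bounded_linear_scaleC_left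
      bounded_bilinear.bounded_linear_left[OF bounded_bilinear_cinner]]
  by (subst bounded_linear_Blinfun_apply) auto

text \<open>Operators of this type carry only real scalars. As an element of \<open>B(H)\<close>,
  this one turns complex multiples into products, which the ideal of compact operators
  absorbs.\<close>

definition cmult_op :: "complex \<Rightarrow> 'a::complex_inner \<Rightarrow>\<^sub>L 'a" where
  "cmult_op c = Blinfun (\<lambda>x. c *\<^sub>C x)"

lemma cmult_op_apply [simp]: "cmult_op c x = c *\<^sub>C x"
  unfolding cmult_op_def using bounded_linear_scaleC_right
  by (subst bounded_linear_Blinfun_apply) auto

lemma cmult_op_bounded_ops: "cmult_op c \<in> bounded_ops"
  by (simp add: bounded_ops_def mult.commute)

lemma outer_bounded_ops: "outer a b \<in> bounded_ops"
  by (simp add: bounded_ops_def cinner_linear)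

lemma compact_ops_add: "S \<in> compact_ops \<Longrightarrow> T \<in> compact_ops \<Longrightarrow> S + T \<in> compact_ops"
  using additive_subgroup.a_closed[OF ideal.axioms(1)[OF ideal_compact_ops], of S T]
  by (simp add: B_ring_def)

lemma compact_ops_zero: "0 \<in> compact_ops"
  using additive_subgroup.zero_closed[OF ideal.axioms(1)[OF ideal_compact_ops]]
  by (simp add: B_ring_def)

lemma compact_ops_compose: "S \<in> bounded_ops \<Longrightarrow> T \<in> compact_ops \<Longrightarrow> S o\<^sub>L T \<in> compact_ops"
  using ideal.I_l_closed[OF ideal_compact_ops, of T S] by (simp add: B_ring_def)

lemma compact_ops_scaleR:
  assumes "T \<in> compact_ops"
  shows "r *\<^sub>R T \<in> compact_ops"
proof -
  have "r *\<^sub>R T = cmult_op (of_real r) o\<^sub>L T"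
    by (rule blinfun_eqI) (simp add: blinfun.scaleR_left scaleR_scaleC)
  then show ?thesis using compact_ops_compose[OF cmult_op_bounded_ops assms] by simp
qed

lemma compact_ops_sum: "(\<And>k. k \<in> K \<Longrightarrow> T k \<in> compact_ops) \<Longrightarrow> (\<Sum>k\<in>K. T k) \<in> compact_ops"
  by (induction K rule: infinite_finite_induct) (auto intro: compact_ops_zero compact_ops_add)

lemma outer_compact_ops: "outer a b \<in> compact_ops"
proof -
  have "outer a b ` cball 0 1 \<subseteq> (\<lambda>c. c *\<^sub>C a) ` cball 0 (norm b)" (is "_ \<subseteq> ?K")
  proof clarify
    fix x :: 'a assume "x \<in> cball 0 1"
    then have "cmod (cinner x b) \<le> norm b"
      using norm_cinner_le[of x b] mult_right_mono[of "norm x" 1 "norm b"] by simp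
    then show "outer a b x \<in> ?K" by auto
  qed
  moreover have "compact ?K"
    by (intro compact_continuous_image linear_continuous_on bounded_linear_scaleC_left compact_cball)
  ultimately show ?thesis
    unfolding compact_ops_def using outer_bounded_ops
    by (metis (no_types, lifting) closed_Int_compact closed_closure closure_minimal compact_imp_closed
        inf.absorb1 mem_Collect_eq)
qed

lemma pi_c_eq_one:
  assumes "T - id_blinfun \<in> compact_ops"
  shows "pi_c T = \<one>\<^bsub>calkin_algebra\<^esub>"
proof -
  interpret I: ideal compact_ops "B_ring :: ('a \<Rightarrow>\<^sub>L 'a) ring" by (rule ideal_compact_ops)
  have "T \<in> compact_ops +>\<^bsub>B_ring\<^esub> id_blinfun"
    unfolding a_r_coset_def' using assms by (force simp: B_ring_def)
  moreover have "id_blinfun \<in> carrier (B_ring :: ('a \<Rightarrow>\<^sub>L 'a) ring)"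
    by (simp add: B_ring_def bounded_ops_def)
  ultimately have "compact_ops +>\<^bsub>B_ring\<^esub> T = compact_ops +>\<^bsub>B_ring\<^esub> id_blinfun"
    by (metis I.a_repr_independence I.a_subgroup)
  then show ?thesis by (simp add: pi_c_def calkin_algebra_def FactRing_def B_ring_def)
qed

section \<open>The almost commuting triples\<close>

text \<open>One instance per member of the sequence. There are \<open>L + 1\<close> vectors joined
  by \<open>L\<close> steps, and the commutators will be of order \<open>1 / L\<close>.\<close>

locale orthonormal_chain =
  fixes f :: "nat \<Rightarrow> 'a::complex_inner" and L :: nat
  assumes L_pos: "0 < L" and orthonormal: "orthonormal_on {..L} f"
begin

definition grid :: "nat \<Rightarrow> real" where
  "grid k = real k / real L"

definition hop :: "nat \<Rightarrow> real" where
  "hop k = 2 * sqrt (grid k * (1 - grid k))"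

definition up :: "'a \<Rightarrow>\<^sub>L 'a" where
  "up = (\<Sum>k<L. outer (hop k *\<^sub>R f (Suc k)) (f k))"

definition down :: "'a \<Rightarrow>\<^sub>L 'a" where
  "down = (\<Sum>k<L. outer (hop k *\<^sub>R f k) (f (Suc k)))"

definition level :: "'a \<Rightarrow>\<^sub>L 'a" where
  "level = (\<Sum>k\<le>L. outer (grid k *\<^sub>R f k) (f k))"

definition proj :: "'a \<Rightarrow>\<^sub>L 'a" where
  "proj = (\<Sum>k\<le>L. outer (f k) (f k))"

text \<open>
  On the span of the \<open>f k\<close> these are the real and imaginary part of the weighted shift \<open>up\<close> and
  the diagonal operator with entries \<open>1 - 2 * grid k\<close>: with \<open>cos \<theta> = 1 - 2 * grid k\<close> and
  \<open>sin \<theta> = hop k\<close> they imitate the coordinate functions of the unit sphere.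
  On the orthogonal complement they are the identity.
\<close>

definition planar :: "complex \<Rightarrow> 'a \<Rightarrow>\<^sub>L 'a" where
  "planar \<omega> = id_blinfun - proj + (1/2) *\<^sub>R ((cmult_op \<omega> o\<^sub>L up) + (cmult_op (cnj \<omega>) o\<^sub>L down))"

definition height :: "'a \<Rightarrow>\<^sub>L 'a" where
  "height = id_blinfun - 2 *\<^sub>R level"

section \<open>Weights and matrix coefficients\<close>

lemma cinner_f: "j \<le> L \<Longrightarrow> k \<le> L \<Longrightarrow> cinner (f j) (f k) = (if j = k then 1 else 0)"
  using orthonormal by (simp add: orthonormal_on_def)

lemma grid_bounds: "0 \<le> grid k" "k \<le> L \<Longrightarrow> grid k \<le> 1"
  using L_pos by (auto simp: grid_def)

lemma grid_0 [simp]: "grid 0 = 0" and grid_L [simp]: "grid L = 1"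
  using L_pos by (auto simp: grid_def)

lemma grid_Suc: "grid (Suc k) = grid k + 1 / L"
  by (simp add: grid_def add_divide_distrib)

text \<open>The weights vanish at both poles. This keeps the commutator of \<open>up\<close> and
  \<open>down\<close> small at the ends of the chain.\<close>

lemma hop_0 [simp]: "hop 0 = 0" and hop_L [simp]: "hop L = 0"
  by (simp_all add: hop_def)

lemma hop_nonneg: "k \<le> L \<Longrightarrow> 0 \<le> hop k"
  using grid_bounds by (simp add: hop_def)

lemma hop_squared: "k \<le> L \<Longrightarrow> (hop k)\<^sup>2 = 4 * (grid k * (1 - grid k))"
  using grid_bounds by (simp add: hop_def power_mult_distrib)

lemma hop_le_1:
  assumes "k \<le> L"
  shows "hop k \<le> 1"
proof -
  have "0 \<le> (1 - 2 * grid k)\<^sup>2" by simp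
  then have "(hop k)\<^sup>2 \<le> 1\<^sup>2"
    unfolding hop_squared[OF assms] by (simp add: power2_eq_square algebra_simps)
  then show ?thesis by (rule power2_le_imp_le) simp
qed

lemma up_apply: "up x = (\<Sum>k<L. (of_real (hop k) * cinner x (f k)) *\<^sub>C f (Suc k))"
  by (simp add: up_def blinfun.sum_left scaleR_scaleC mult.commute)

lemma down_apply: "down x = (\<Sum>k<L. (of_real (hop k) * cinner x (f (Suc k))) *\<^sub>C f k)"
  by (simp add: down_def blinfun.sum_left scaleR_scaleC mult.commute)

lemma level_apply: "level x = (\<Sum>k\<le>L. (of_real (grid k) * cinner x (f k)) *\<^sub>C f k)"
  by (simp add: level_def blinfun.sum_left scaleR_scaleC mult.commute)

lemma proj_apply: "proj x = orthoproj {..L} f x"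
  by (simp add: proj_def blinfun.sum_left orthoproj_def)

lemma planar_apply: "planar \<omega> x = x - proj x + (1/2) *\<^sub>R (\<omega> *\<^sub>C up x + cnj \<omega> *\<^sub>C down x)"
  by (simp add: planar_def blinfun.add_left blinfun.diff_left blinfun.scaleR_left)

lemma height_apply: "height x = x - 2 *\<^sub>R level x"
  by (simp add: height_def blinfun.diff_left blinfun.scaleR_left)

lemma chain_bounded_ops:
  "up \<in> bounded_ops" "down \<in> bounded_ops" "level \<in> bounded_ops" "proj \<in> bounded_ops"
  by (auto simp: bounded_ops_def up_def down_def level_def proj_def blinfun.sum_left cinner_linear
      scaleC.scale_sum_right)

lemmas chain_scaleC = chain_bounded_ops[THEN bounded_opsD]
lemmas chain_sum = chain_bounded_ops[THEN blinfun_sum_scaleC]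

lemma cinner_sum_f: "j \<le> L \<Longrightarrow> cinner (\<Sum>k\<le>L. c k *\<^sub>C f k) (f j) = c j"
  using cinner_sum_orthonormal[OF orthonormal, of "{..L}" j c] by simp

lemma proj_f: "j \<le> L \<Longrightarrow> proj (f j) = f j"
  by (simp add: proj_apply orthoproj_def cinner_f if_distrib[where f = "\<lambda>c. c *\<^sub>C _"] cong: if_cong)

lemma level_f: "j \<le> L \<Longrightarrow> level (f j) = of_real (grid j) *\<^sub>C f j"
  by (simp add: level_apply cinner_f if_distrib[where f = "\<lambda>c. c *\<^sub>C _"] if_distrib[where f = "\<lambda>c. _ * c"]
      cong: if_cong)

lemma cinner_proj: "j \<le> L \<Longrightarrow> cinner (proj x) (f j) = cinner x (f j)"
  by (simp add: proj_apply orthoproj_def cinner_sum_f)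

lemma cinner_level: "j \<le> L \<Longrightarrow> cinner (level x) (f j) = of_real (grid j) * cinner x (f j)"
  by (simp add: level_apply cinner_sum_f)

lemma cinner_up: "k < L \<Longrightarrow> cinner (up x) (f (Suc k)) = of_real (hop k) * cinner x (f k)"
  by (simp add: up_apply cinner_sum_left cinner_scaleC_left cinner_f if_distrib[where f = "\<lambda>c. _ * c"]
      cong: if_cong)

lemma cinner_down: "k < L \<Longrightarrow> cinner (down x) (f k) = of_real (hop k) * cinner x (f (Suc k))"
  by (simp add: down_apply cinner_sum_left cinner_scaleC_left cinner_f if_distrib[where f = "\<lambda>c. _ * c"]
      cong: if_cong)

lemma proj_range:
  "proj (up x) = up x" "proj (down x) = down x" "proj (level x) = level x"
  by (simp_all add: up_apply down_apply level_apply chain_sum proj_f)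

lemma range_proj:
  "up (proj x) = up x" "down (proj x) = down x" "level (proj x) = level x"
  by (simp_all add: up_apply down_apply level_apply cinner_proj)

section \<open>Norm bounds\<close>

lemma norm_up_le: "norm (up x) \<le> norm (proj x)"
proof -
  have "norm (up x) \<le> 1 * norm (orthoproj {..L} f x)" unfolding up_apply
    by (rule norm_weighted_sum_le[OF orthonormal]) (auto simp: hop_nonneg hop_le_1)
  then show ?thesis by (simp add: proj_apply)
qed

lemma norm_weighted_down_le:
  assumes "\<And>k. k < L \<Longrightarrow> cmod (w k) \<le> m" "0 \<le> m"
  shows "norm (\<Sum>k<L. (w k * cinner x (f (Suc k))) *\<^sub>C f k) \<le> m * norm (proj x)"
proof -
  \<comment> \<open>Reindexed by the source vector, as \<open>norm_weighted_sum_le\<close> expects;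
    starting at 1 makes \<open>k - 1\<close> injective.\<close>
  have "(\<Sum>k<L. (w k * cinner x (f (Suc k))) *\<^sub>C f k) =
      (\<Sum>k\<in>{1..L}. (w (k - 1) * cinner x (f k)) *\<^sub>C f (k - 1))"
    by (rule sum.reindex_bij_witness[of _ "\<lambda>k. k - 1" Suc]) auto
  also have "norm \<dots> \<le> m * norm (orthoproj {..L} f x)"
    by (rule norm_weighted_sum_le[OF orthonormal]) (use assms in \<open>auto simp: inj_on_def\<close>)
  finally show ?thesis by (simp add: proj_apply)
qed

lemma norm_down_le: "norm (down x) \<le> norm (proj x)"
  using norm_weighted_down_le[of "\<lambda>k. of_real (hop k)" 1 x] by (simp add: down_apply hop_nonneg hop_le_1)

lemma norm_proj_le: "norm (proj x) \<le> norm x"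
  unfolding proj_apply by (rule norm_orthoproj_le[OF orthonormal]) simp

text \<open>For an operator that is the identity off the chain, only its part on the chain has to be
  shown contractive.\<close>

lemma norm_residual_add_le:
  assumes v: "proj v = v" and le: "norm v \<le> norm (proj x)"
  shows "norm (x - proj x + v) \<le> norm x"
proof -
  have "(norm (x - proj x + v))\<^sup>2 = (norm (x - proj x))\<^sup>2 + (norm v)\<^sup>2"
    using norm_residual_add_squared[OF orthonormal, of x "\<lambda>i. cinner v (f i)"] v
    by (simp add: proj_apply orthoproj_def)
  also have "\<dots> \<le> (norm (x - proj x))\<^sup>2 + (norm (proj x))\<^sup>2"
    using le by (simp add: power_mono)
  also have "\<dots> = (norm x)\<^sup>2"
    using norm_squared_orthoproj[OF orthonormal, of x] by (simp add: proj_apply)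
  finally show ?thesis by (rule power2_le_imp_le) simp
qed

lemma norm_planar_le:
  assumes "cmod \<omega> = 1"
  shows "norm (planar \<omega>) \<le> 1"
proof (rule norm_blinfun_bound)
  fix x
  define v where "v = (1/2) *\<^sub>R (\<omega> *\<^sub>C up x + cnj \<omega> *\<^sub>C down x)"
  have "proj v = v"
    by (simp add: v_def blinfun.scaleR_right blinfun.add_right chain_scaleC proj_range)
  moreover have "norm v \<le> norm (proj x)"
    using norm_triangle_ineq[of "\<omega> *\<^sub>C up x" "cnj \<omega> *\<^sub>C down x"] norm_up_le[of x] norm_down_le[of x] assms
    by (simp add: v_def norm_scaleC)
  ultimately show "norm (planar \<omega> x) \<le> 1 * norm x"
    using norm_residual_add_le[of v x] by (simp add: planar_apply v_def)
qed simp

lemma norm_height_le: "norm height \<le> 1"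
proof (rule norm_blinfun_bound)
  fix x
  define v where "v = proj x - 2 *\<^sub>R level x"
  have "proj (proj x) = proj x"
    by (simp add: proj_apply[of "proj x"] orthoproj_def cinner_proj) (simp add: proj_apply orthoproj_def)
  then have "proj v = v"
    by (simp add: v_def blinfun.diff_right blinfun.scaleR_right proj_range)
  moreover have "norm v \<le> norm (proj x)"
  proof -
    have "v = (\<Sum>k\<le>L. (of_real (1 - 2 * grid k) * cinner x (f k)) *\<^sub>C f k)"
      unfolding v_def proj_apply orthoproj_def level_apply scaleR_scaleC scaleC.scale_sum_right
        sum_subtractf[symmetric]
      by (rule sum.cong) (simp_all add: scaleC.scale_left_diff_distrib[symmetric] left_diff_distrib)
    also have "norm \<dots> \<le> 1 * norm (orthoproj {..L} f x)"
    proof (rule norm_weighted_sum_le[OF orthonormal])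
      show "cmod (of_real (1 - 2 * grid k)) \<le> 1" if "k \<in> {..L}" for k
        unfolding norm_of_real using grid_bounds[of k] that by (simp add: abs_le_iff)
    qed auto
    finally show ?thesis by (simp add: proj_apply)
  qed
  ultimately show "norm (height x) \<le> 1 * norm x"
    using norm_residual_add_le[of v x] by (simp add: height_apply v_def)
qed simp

section \<open>Self-adjointness\<close>

lemma up_adjoint: "cinner (up x) y = cinner x (down y)"
  by (simp add: up_apply down_apply cinner_sum_left cinner_sum_right cinner_linear mult_ac
      cinner_commute[of "f _" y])

lemma level_adjoint: "cinner (level x) y = cinner x (level y)"
  by (simp add: level_apply cinner_sum_left cinner_sum_right cinner_linear mult_ac
      cinner_commute[of "f _" y])

lemma proj_adjoint: "cinner (proj x) y = cinner x (proj y)"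
  by (simp add: proj_apply orthoproj_def cinner_sum_left cinner_sum_right cinner_linear mult_ac
      cinner_commute[of "f _" y])

lemma down_adjoint: "cinner (down x) y = cinner x (up y)"
  by (metis cinner_commute up_adjoint)

lemma self_adjoint_planar: "self_adjoint (planar \<omega>)"
  unfolding self_adjoint_def bounded_ops_def
  by (simp add: planar_apply chain_scaleC scaleC_add_right scaleC.scale_right_diff_distrib scaleR_scaleC mult_ac
      cinner_linear up_adjoint down_adjoint proj_adjoint add.commute)

lemma self_adjoint_height: "self_adjoint height"
  unfolding self_adjoint_def bounded_ops_def
  by (simp add: height_apply chain_scaleC scaleC.scale_right_diff_distrib scaleR_scaleC mult_ac
      cinner_linear level_adjoint)

section \<open>Images in the Calkin algebra\<close>

lemma chain_compact_ops:
  "up \<in> compact_ops" "down \<in> compact_ops" "level \<in> compact_ops" "proj \<in> compact_ops"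
  unfolding up_def down_def level_def proj_def by (intro compact_ops_sum outer_compact_ops)+

lemma pi_c_planar: "pi_c (planar \<omega>) = \<one>\<^bsub>calkin_algebra\<^esub>"
proof (rule pi_c_eq_one)
  have "planar \<omega> - id_blinfun =
      (- 1) *\<^sub>R proj + (1/2) *\<^sub>R ((cmult_op \<omega> o\<^sub>L up) + (cmult_op (cnj \<omega>) o\<^sub>L down))"
    by (simp add: planar_def)
  also have "\<dots> \<in> compact_ops"
    by (intro compact_ops_add compact_ops_scaleR compact_ops_compose cmult_op_bounded_ops chain_compact_ops)
  finally show "planar \<omega> - id_blinfun \<in> compact_ops" .
qed

lemma pi_c_height: "pi_c height = \<one>\<^bsub>calkin_algebra\<^esub>"
proof (rule pi_c_eq_one)
  have "height - id_blinfun = (- 2) *\<^sub>R level" by (simp add: height_def)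
  also have "\<dots> \<in> compact_ops" by (intro compact_ops_scaleR chain_compact_ops)
  finally show "height - id_blinfun \<in> compact_ops" .
qed

section \<open>Commutator estimates\<close>

lemma level_up: "level (up x) - up (level x) = (\<Sum>k<L. (of_real (hop k / L) * cinner x (f k)) *\<^sub>C f (Suc k))"
proof -
  have "level (up x) = (\<Sum>k<L. (of_real (hop k) * cinner x (f k)) *\<^sub>C of_real (grid (Suc k)) *\<^sub>C f (Suc k))"
    unfolding up_apply chain_sum by (rule sum.cong) (simp_all add: level_f)
  moreover have "up (level x) = (\<Sum>k<L. (of_real (hop k) * (of_real (grid k) * cinner x (f k))) *\<^sub>C f (Suc k))"
    unfolding up_apply by (rule sum.cong) (simp_all add: cinner_level)
  \<comment> \<open>A step of the shift raises the level by exactly \<open>1 / L\<close>, so the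
    commutator is the same shift with weights divided by \<open>L\<close>.\<close>
  ultimately show ?thesis
    by (simp add: sum_subtractf[symmetric] scaleC.scale_left_diff_distrib[symmetric] grid_Suc
        algebra_simps)
qed

lemma level_down:
  "level (down x) - down (level x) = (\<Sum>k<L. (of_real (- hop k / L) * cinner x (f (Suc k))) *\<^sub>C f k)"
proof -
  have "level (down x) = (\<Sum>k<L. (of_real (hop k) * cinner x (f (Suc k))) *\<^sub>C of_real (grid k) *\<^sub>C f k)"
    unfolding down_apply chain_sum by (rule sum.cong) (simp_all add: level_f)
  moreover have "down (level x) =
      (\<Sum>k<L. (of_real (hop k) * (of_real (grid (Suc k)) * cinner x (f (Suc k)))) *\<^sub>C f k)"
    unfolding down_apply by (rule sum.cong) (simp_all add: cinner_level)
  ultimately show ?thesis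
    by (simp add: sum_subtractf[symmetric] scaleC.scale_left_diff_distrib[symmetric] grid_Suc
        algebra_simps)
qed

lemma norm_level_up_le: "norm (level (up x) - up (level x)) \<le> norm x / L"
proof -
  have "norm (level (up x) - up (level x)) \<le> 1 / real L * norm (orthoproj {..L} f x)"
    unfolding level_up
  proof (rule norm_weighted_sum_le[OF orthonormal])
    show "cmod (of_real (hop k / L)) \<le> 1 / real L" if "k \<in> {..<L}" for k
      unfolding norm_of_real using that L_pos hop_le_1[of k] hop_nonneg[of k] by (simp add: divide_right_mono)
  qed auto
  also have "\<dots> \<le> 1 / real L * norm x"
    using norm_proj_le[of x] by (intro mult_left_mono) (simp_all add: proj_apply)
  finally show ?thesis by simp
qed

lemma norm_level_down_le: "norm (level (down x) - down (level x)) \<le> norm x / L"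
proof -
  have "norm (level (down x) - down (level x)) \<le> 1 / real L * norm (proj x)"
    unfolding level_down
  proof (rule norm_weighted_down_le)
    show "cmod (of_real (- hop k / L)) \<le> 1 / real L" if "k < L" for k
      unfolding norm_of_real using that L_pos hop_le_1[of k] hop_nonneg[of k] by (simp add: divide_right_mono)
  qed auto
  also have "\<dots> \<le> 1 / real L * norm x"
    using norm_proj_le[of x] by (intro mult_left_mono) simp_all
  finally show ?thesis by simp
qed

text \<open>The identity parts and \<open>proj\<close> commute with \<open>level\<close>, and the
  factor 2 of \<open>height\<close> cancels the 1/2 of \<open>planar\<close>. Two commutators
  remain, each of norm at most \<open>1 / L\<close>.\<close>

lemma norm_planar_height_commutator_le:
  assumes "cmod \<omega> = 1"
  shows "norm ((planar \<omega> o\<^sub>L height) - (height o\<^sub>L planar \<omega>)) \<le> 2 / real L"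
proof (rule norm_blinfun_bound)
  fix x
  have "proj (level x) = level (proj x)" by (simp add: proj_range range_proj)
  then have "((planar \<omega> o\<^sub>L height) - (height o\<^sub>L planar \<omega>)) x =
      \<omega> *\<^sub>C (level (up x) - up (level x)) + cnj \<omega> *\<^sub>C (level (down x) - down (level x))"
    by (simp add: blinfun.diff_left blinfun.diff_right planar_apply height_apply blinfun.add_right
        blinfun.scaleR_right chain_scaleC scaleC_add_right scaleC.scale_right_diff_distrib
        scaleR_add_right scaleR_diff_right scaleR_scaleC mult_ac)
  also have "norm \<dots> \<le> norm x / L + norm x / L"
    using norm_level_up_le[of x] norm_level_down_le[of x] assms
    by (intro norm_triangle_le add_mono) (simp_all add: norm_scaleC)
  finally show "norm (((planar \<omega> o\<^sub>L height) - (height o\<^sub>L planar \<omega>)) x) \<le> 2 / real L * norm x" by simp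
qed simp

lemma up_down: "up (down x) - down (up x) =
  (\<Sum>k\<le>L. (of_real ((hop (k - 1))\<^sup>2 - (hop k)\<^sup>2) * cinner x (f k)) *\<^sub>C f k)"
proof -
  let ?g = "\<lambda>k. cinner x (f k) *\<^sub>C f k"
  have "up (down x) = (\<Sum>k<L. of_real ((hop k)\<^sup>2) *\<^sub>C ?g (Suc k))"
    unfolding up_apply by (rule sum.cong) (simp_all add: cinner_down power2_eq_square mult_ac)
  \<comment> \<open>The new term at \<open>k = 0\<close> reads
    \<open>hop (0 - 1) = hop 0 = 0\<close>. In the other product the new term at
    \<open>k = L\<close> vanishes by \<open>hop L = 0\<close>.\<close>
  also have "\<dots> = (\<Sum>k<Suc L. of_real ((hop (k - 1))\<^sup>2) *\<^sub>C ?g k)"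
    by (subst sum.lessThan_Suc_shift) simp
  finally have 1: "up (down x) = (\<Sum>k\<le>L. of_real ((hop (k - 1))\<^sup>2) *\<^sub>C ?g k)"
    by (simp add: lessThan_Suc_atMost)
  have "down (up x) = (\<Sum>k<L. of_real ((hop k)\<^sup>2) *\<^sub>C ?g k)"
    unfolding down_apply by (rule sum.cong) (simp_all add: cinner_up power2_eq_square mult_ac)
  also have "\<dots> = (\<Sum>k<Suc L. of_real ((hop k)\<^sup>2) *\<^sub>C ?g k)" by simp
  finally have 2: "down (up x) = (\<Sum>k\<le>L. of_real ((hop k)\<^sup>2) *\<^sub>C ?g k)"
    by (simp add: lessThan_Suc_atMost)
  show ?thesis unfolding 1 2 sum_subtractf[symmetric]
    by (rule sum.cong) (simp_all add: scaleC.scale_left_diff_distrib[symmetric] left_diff_distrib)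
qed

text \<open>The squared weight is \<open>4 * t * (1 - t)\<close> at \<open>t = grid k\<close>, which
  has slope at most 4 on the unit interval. At \<open>k = 0\<close> truncation makes the difference
  0.\<close>

lemma hop_squared_diff_le:
  assumes "k \<le> L"
  shows "\<bar>(hop (k - 1))\<^sup>2 - (hop k)\<^sup>2\<bar> \<le> 4 / real L"
proof (cases k)
  case (Suc j)
  have "(hop j)\<^sup>2 - (hop k)\<^sup>2 = 4 / real L * (grid j + grid k - 1)"
    using assms Suc by (simp add: hop_squared grid_Suc algebra_simps)
  then have "\<bar>(hop j)\<^sup>2 - (hop k)\<^sup>2\<bar> = 4 / real L * \<bar>grid j + grid k - 1\<bar>"
    by (simp only: abs_mult) simp
  moreover have "\<bar>grid j + grid k - 1\<bar> \<le> 1"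
    using grid_bounds[of j] grid_bounds[of k] assms Suc by (simp add: abs_le_iff)
  then have "4 / real L * \<bar>grid j + grid k - 1\<bar> \<le> 4 / real L * 1" by (intro mult_left_mono) auto
  ultimately show ?thesis using Suc by simp
qed simp

lemma norm_up_down_le: "norm (up (down x) - down (up x)) \<le> 4 / real L * norm x"
proof -
  have "norm (up (down x) - down (up x)) \<le> 4 / real L * norm (orthoproj {..L} f x)"
    unfolding up_down
  proof (rule norm_weighted_sum_le[OF orthonormal])
    show "cmod (of_real ((hop (k - 1))\<^sup>2 - (hop k)\<^sup>2)) \<le> 4 / real L" if "k \<in> {..L}" for k
      unfolding norm_of_real using that by (intro hop_squared_diff_le) simp
  qed auto
  also have "\<dots> \<le> 4 / real L * norm x"
    using norm_proj_le[of x] by (intro mult_left_mono) (simp_all add: proj_apply)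
  finally show ?thesis .
qed

lemma norm_planar_commutator_le:
  "norm ((planar 1 o\<^sub>L planar \<i>) - (planar \<i> o\<^sub>L planar 1)) \<le> 2 / real L"
proof (rule norm_blinfun_bound)
  fix x
  have pp: "proj (proj x) = proj x"
    by (simp add: proj_apply[of "proj x"] orthoproj_def cinner_proj) (simp add: proj_apply orthoproj_def)
  define H where "H \<omega> x = (1/2) *\<^sub>R (\<omega> *\<^sub>C up x + cnj \<omega> *\<^sub>C down x)" for \<omega> x
  \<comment> \<open>Off the chain the product is the identity, so only the chain parts
    \<open>H\<close> contribute to the commutator, which reduces to that of \<open>up\<close> and
    \<open>down\<close>.\<close>
  have "planar \<omega> (planar \<omega>' x) = x - proj x + H \<omega> (H \<omega>' x)" for \<omega> \<omega>'
  proof -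
    have pH: "proj (H \<omega>' x) = H \<omega>' x"
      by (simp add: H_def blinfun.scaleR_right blinfun.add_right chain_scaleC proj_range)
    define w where "w = planar \<omega>' x"
    have w: "w = x - proj x + H \<omega>' x" by (simp add: w_def planar_apply H_def)
    have pw: "proj w = H \<omega>' x" by (simp add: w blinfun.add_right blinfun.diff_right pp pH)
    then have "H \<omega> w = H \<omega> (H \<omega>' x)"
      unfolding H_def[of \<omega>] using range_proj(1,2)[of w] by simp
    then have "planar \<omega> w = w - H \<omega>' x + H \<omega> (H \<omega>' x)"
      using pw by (simp add: planar_apply H_def[of \<omega>, symmetric])
    then show ?thesis by (simp add: w w_def[symmetric])
  qed
  then have "((planar 1 o\<^sub>L planar \<i>) - (planar \<i> o\<^sub>L planar 1)) x = H 1 (H \<i> x) - H \<i> (H 1 x)"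
    by (simp add: blinfun.diff_left)
  also have "\<dots> = (- \<i> / 2) *\<^sub>C (up (down x) - down (up x))"
  proof -
    let ?y = "(\<i> / 4) *\<^sub>C (up (up x) - up (down x) + down (up x) - down (down x))"
    let ?z = "(\<i> / 4) *\<^sub>C (up (up x) + up (down x) - down (up x) - down (down x))"
    have "H 1 (H \<i> x) = ?y" "H \<i> (H 1 x) = ?z"
      by (simp_all add: H_def blinfun.add_right blinfun.diff_right blinfun.scaleR_right chain_scaleC
          scaleR_scaleC scaleC_add_right scaleC.scale_right_diff_distrib)
    then have "H 1 (H \<i> x) - H \<i> (H 1 x) = ?y - ?z" by simp
    also have "\<dots> = (\<i> / 4) *\<^sub>C of_real (- 2) *\<^sub>C (up (down x) - down (up x))"
      unfolding scaleC.scale_right_diff_distrib[symmetric] scaleR_scaleC[symmetric]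
      by (simp add: algebra_simps scaleR_2)
    finally show ?thesis by simp
  qed
  also have "norm \<dots> = norm (up (down x) - down (up x)) / 2" by (simp add: norm_scaleC norm_divide)
  finally show "norm (((planar 1 o\<^sub>L planar \<i>) - (planar \<i> o\<^sub>L planar 1)) x) \<le> 2 / real L * norm x"
    using norm_up_down_le[of x] by simp
qed simp

section \<open>Lower bound for the form of the triple\<close>

lemma norm_proj_squared: "(norm (proj x))\<^sup>2 = (\<Sum>k\<le>L. (cmod (cinner x (f k)))\<^sup>2)"
  unfolding proj_apply by (rule norm_orthoproj_squared[OF orthonormal]) simp

lemma height_form:
  "Re (cinner (height x) x) = (norm x)\<^sup>2 - 2 * (\<Sum>k\<le>L. grid k * (cmod (cinner x (f k)))\<^sup>2)"
proof -
  have "cinner (level x) x = (\<Sum>k\<le>L. of_real (grid k * (cmod (cinner x (f k)))\<^sup>2))"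
    unfolding level_apply cinner_sum_left cinner_scaleC_left
    by (rule sum.cong)
      (auto simp: complex_norm_square cinner_commute[of "f _" x] simp del: of_real_power)
  then show ?thesis by (simp add: height_apply cinner_linear cinner_self)
qed

text \<open>
  Up to the error \<open>2 / L\<close> coming from \<open>grid (Suc k) - grid k\<close>, the vectors
  \<open>(sqrt (1 - grid k) * f (Suc k), sqrt (grid k) * f k)\<close> are eigenvectors of the Pauli
  combination for the eigenvalue 1. Together with \<open>(f 0, 0)\<close> and \<open>(0, f L)\<close> there are
  \<open>L + 2\<close> of them, one more than half the dimension of the space they live in. The truncated
  \<open>0 - 1 = 0\<close> in \<open>grid (k - 1)\<close> gives \<open>f 0\<close> the intended weight \<open>sqrt (1 - grid 0) = 1\<close>.
\<close>

lemma pauli_form_ge: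
  assumes L: "4 \<le> L"
    and x: "\<And>k. k \<le> L \<Longrightarrow> cinner x (f k) = of_real (sqrt (1 - grid (k - 1))) * \<alpha> k"
    and y: "y = (\<Sum>k\<le>L. (of_real (sqrt (grid k)) * \<alpha> (Suc k)) *\<^sub>C f k)"
  shows "((norm x)\<^sup>2 + (norm y)\<^sup>2) / 2 \<le> pauli_form (planar 1) (planar \<i>) height x y"
proof -
  \<comment> \<open>\<open>\<alpha> 0\<close> is left out: it enters only through the coordinate of
    \<open>x\<close> at \<open>f 0\<close>, where the level is 0.\<close>
  define A where "A k = (cmod (\<alpha> (Suc k)))\<^sup>2" for k
  have A: "0 \<le> A k" for k by (simp add: A_def)
  have xk: "(cmod (cinner x (f (Suc k))))\<^sup>2 = (1 - grid k) * A k" if "k < L" for k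
    using x[of "Suc k"] that grid_bounds[of k]
    by (simp add: norm_mult power_mult_distrib A_def)
  have yk: "cinner y (f k) = of_real (sqrt (grid k)) * \<alpha> (Suc k)" if "k \<le> L" for k
    using that by (simp add: y cinner_sum_f)
  then have yk2: "(cmod (cinner y (f k)))\<^sup>2 = grid k * A k" if "k \<le> L" for k
    using that grid_bounds[of k] by (simp add: norm_mult power_mult_distrib A_def)
  have split_first: "(\<Sum>k\<le>L. h k) = h 0 + (\<Sum>k<L. h (Suc k))" for h :: "nat \<Rightarrow> real"
    unfolding lessThan_Suc_atMost[symmetric] by (rule sum.lessThan_Suc_shift)
  have drop_last: "(\<Sum>k<L. h k) = (\<Sum>k\<le>L. h k)" if "h L = 0" for h :: "nat \<Rightarrow> real"
    using that by (simp add: lessThan_Suc_atMost[symmetric])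
  have "(\<Sum>k\<le>L. grid k * (cmod (cinner x (f k)))\<^sup>2) = (\<Sum>k<L. grid (Suc k) * ((1 - grid k) * A k))"
    unfolding split_first by (simp add: xk)
  also have "\<dots> = (\<Sum>k\<le>L. (grid k + 1 / real L) * ((1 - grid k) * A k))"
    unfolding grid_Suc by (rule drop_last) simp
  finally have hx: "Re (cinner (height x) x) =
      (norm x)\<^sup>2 - 2 * (\<Sum>k\<le>L. (grid k + 1 / real L) * ((1 - grid k) * A k))"
    by (simp add: height_form)
  have py: "proj y = y" by (simp add: y chain_sum proj_f)
  have ny: "(norm y)\<^sup>2 = (\<Sum>k\<le>L. grid k * A k)"
    using norm_proj_squared[of y] by (simp add: py yk2)
  have hy: "Re (cinner (height y) y) = (\<Sum>k\<le>L. grid k * A k) - 2 * (\<Sum>k\<le>L. grid k * (grid k * A k))"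
    unfolding height_form ny by (simp add: yk2)
  \<comment> \<open>Since \<open>y\<close> lies in the span of the chain, the combination
    \<open>T1 - i T2\<close> acts on it as the shift \<open>up\<close> alone.\<close>
  have "planar 1 y = (1/2) *\<^sub>R (up y + down y)" "\<i> *\<^sub>C planar \<i> y = (1/2) *\<^sub>R (down y - up y)"
    by (simp_all add: planar_apply py scaleR_scaleC scaleC_add_right scaleC.scale_right_diff_distrib)
  then have "planar 1 y - \<i> *\<^sub>C planar \<i> y = (1/2) *\<^sub>R (up y + up y)"
    by (simp add: scaleR_diff_right[symmetric])
  then have "planar 1 y - \<i> *\<^sub>C planar \<i> y = up y" by simp
  moreover have "cinner (up y) x = (\<Sum>k<L. of_real (2 * (grid k * (1 - grid k)) * A k))"
    unfolding up_apply cinner_sum_left cinner_scaleC_left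
  proof (rule sum.cong)
    fix k assume "k \<in> {..<L}"
    then have k: "k < L" by simp
    define s c where "s = sqrt (grid k)" and "c = sqrt (1 - grid k)"
    have sc: "s * s = grid k" "c * c = 1 - grid k" "hop k = 2 * (s * c)"
      using grid_bounds[of k] k by (simp_all add: s_def c_def hop_def real_sqrt_mult)
    have "cinner (f (Suc k)) x = cnj (of_real c * \<alpha> (Suc k))"
      using cinner_commute[of "f (Suc k)" x] x[of "Suc k"] k by (simp add: c_def)
    moreover have "cinner y (f k) = of_real s * \<alpha> (Suc k)" using yk[of k] k by (simp add: s_def)
    ultimately have "of_real (hop k) * cinner y (f k) * cinner (f (Suc k)) x =
        of_real (2 * ((s * s) * (c * c))) * (\<alpha> (Suc k) * cnj (\<alpha> (Suc k)))"
      unfolding sc(3) by (simp add: mult_ac)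
    also have "\<dots> = of_real (2 * (grid k * (1 - grid k)) * A k)"
      unfolding sc(1,2) complex_norm_square[symmetric] A_def of_real_mult by simp
    finally show "of_real (hop k) * cinner y (f k) * cinner (f (Suc k)) x =
        of_real (2 * (grid k * (1 - grid k)) * A k)" .
  qed simp
  moreover have "(\<Sum>k<L. 2 * (grid k * (1 - grid k)) * A k) = (\<Sum>k\<le>L. 2 * (grid k * (1 - grid k)) * A k)"
    by (rule drop_last) simp
  ultimately have cross: "Re (cinner (planar 1 y - \<i> *\<^sub>C planar \<i> y) x) =
      (\<Sum>k\<le>L. 2 * (grid k * (1 - grid k)) * A k)"
    by (simp del: of_real_mult of_real_diff)
  \<comment> \<open>Only an inequality, since \<open>x\<close> may have a component off the chain
    and one along \<open>f 0\<close>.\<close>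
  have "(\<Sum>k\<le>L. (1 - grid k) * A k) = (\<Sum>k<L. (1 - grid k) * A k)"
    by (rule drop_last[symmetric]) simp
  also have "\<dots> \<le> (\<Sum>k\<le>L. (cmod (cinner x (f k)))\<^sup>2)"
    unfolding split_first by (simp add: xk)
  also have "\<dots> \<le> (norm x)\<^sup>2"
    unfolding norm_proj_squared[symmetric] by (intro power_mono norm_proj_le) simp
  finally have nx: "(\<Sum>k\<le>L. (1 - grid k) * A k) \<le> (norm x)\<^sup>2" .
  \<comment> \<open>With half of each squared norm subtracted and \<open>nx\<close> used for the
    remaining half of that of \<open>x\<close>, everything of order 1 in the coefficient of
    \<open>A k\<close> cancels down to 1/2. What is left is the grid error, at most 1/2 because
    \<open>L\<close> is at least 4.\<close>
  have "0 \<le> (\<Sum>k\<le>L. (1 / 2 - 2 / real L * (1 - grid k)) * A k)"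
  proof (intro sum_nonneg mult_nonneg_nonneg A)
    fix k assume "k \<in> {..L}"
    then have "2 / real L * (1 - grid k) \<le> 2 / real L * 1"
      using grid_bounds[of k] by (intro mult_left_mono) auto
    also have "\<dots> \<le> 1 / 2" using L by (simp add: field_simps)
    finally show "0 \<le> 1 / 2 - 2 / real L * (1 - grid k)" by simp
  qed
  also have "\<dots> = (\<Sum>k\<le>L. (1 - grid k) * A k) / 2 - 2 * (\<Sum>k\<le>L. (grid k + 1 / real L) * ((1 - grid k) * A k))
      - ((\<Sum>k\<le>L. grid k * A k) - 2 * (\<Sum>k\<le>L. grid k * (grid k * A k)))
      + 2 * (\<Sum>k\<le>L. 2 * (grid k * (1 - grid k)) * A k) - (\<Sum>k\<le>L. grid k * A k) / 2"
    unfolding sum_distrib_left sum_divide_distrib sum_subtractf[symmetric] sum.distrib[symmetric]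
    by (rule sum.cong) (use L_pos in \<open>simp_all add: field_simps\<close>)
  finally show ?thesis
    using nx unfolding pauli_form_def hx hy cross ny by (simp add: field_simps)
qed

end

section \<open>Distance to commuting triples\<close>

lemma orthonormal_chain_not_near_commuting:
  fixes f :: "nat \<Rightarrow> 'a::complex_hilbert_space"
  assumes "orthonormal_chain f L" and L: "4 \<le> L"
    and S: "self_adjoint S1" "self_adjoint S2" "self_adjoint S3"
    and comm: "S1 o\<^sub>L S3 = S3 o\<^sub>L S1" "S2 o\<^sub>L S3 = S3 o\<^sub>L S2"
    and near: "norm (orthonormal_chain.planar f L 1 - S1) \<le> 1/8"
      "norm (orthonormal_chain.planar f L \<i> - S2) \<le> 1/8"
      "norm (orthonormal_chain.height f L - S3) \<le> 1/8"
  shows False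
proof -
  interpret orthonormal_chain f L by fact
  \<comment> \<open>Off the chain \<open>height\<close> is the identity, and an error of 1/8 cannot
    destroy positivity.\<close>
  have "0 < Re (cinner (S3 x) x)" if "\<And>k. k \<in> {..L} \<Longrightarrow> cinner x (f k) = 0" "x \<noteq> 0" for x
  proof -
    have "Re (cinner (height x) x) = (norm x)\<^sup>2" using that(1) by (simp add: height_form)
    moreover have "Re (cinner ((height - S3) x) x) = Re (cinner (height x) x) - Re (cinner (S3 x) x)"
      by (simp add: blinfun.diff_left cinner_linear)
    moreover have "\<bar>Re (cinner ((height - S3) x) x)\<bar> \<le> 1/8 * (norm x)\<^sup>2"
      using Re_cinner_blinfun_le[OF near(3), of x x] by (simp add: power2_eq_square)
    moreover have "(norm x)\<^sup>2 > 0" using that(2) by simp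
    ultimately show ?thesis by linarith
  qed
  from exists_complete_negative_eigenbasis[OF S(3) orthonormal _ this]
  obtain m e where e: "negative_eigenbasis S3 m e"
    and nonneg: "\<And>x. (\<And>k. k < m \<Longrightarrow> cinner x (e k) = 0) \<Longrightarrow> 0 \<le> Re (cinner (S3 x) x)" by auto
  from e have orth: "orthonormal_on {..<m} e" by (simp add: negative_eigenbasis_def)
  \<comment> \<open>The unknowns are the \<open>L + 2\<close> numbers \<open>\<alpha>\<close> and
    the \<open>m\<close> coordinates \<open>\<beta>\<close> of \<open>x\<close> in the eigenbasis.
    The \<open>L + 1\<close> rows \<open>Inl\<close> impose the coordinates of \<open>x\<close>
    along the chain required by \<open>pauli_form_ge\<close>; the \<open>m\<close> rows
    \<open>Inr\<close> make \<open>y\<close> orthogonal to the eigenbasis.\<close>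
  define M :: "nat + nat \<Rightarrow> nat + nat \<Rightarrow> complex" where
    "M i j = (case i of
        Inl k \<Rightarrow> (case j of Inl k' \<Rightarrow> if k' = k then - of_real (sqrt (1 - grid (k - 1))) else 0
                   | Inr l \<Rightarrow> cinner (e l) (f k))
      | Inr l \<Rightarrow> (case j of Inl k' \<Rightarrow> of_real (sqrt (grid (k' - 1))) * cinner (f (k' - 1)) (e l)
                   | Inr _ \<Rightarrow> 0))" for i j
  define E U where "E = Sum_Type.Plus {..L} {..<m}" and "U = Sum_Type.Plus {..Suc L} {..<m}"
  have "card E < card U" and fin: "finite E" "finite U" by (simp_all add: E_def U_def card_Plus)
  then have "\<exists>a. (\<exists>j\<in>U. a j \<noteq> 0) \<and> (\<forall>i\<in>E. (\<Sum>j\<in>U. M i j * a j) = 0)"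
    by (intro homogeneous_system_nontrivial)
  then obtain a where a: "\<exists>j\<in>U. a j \<noteq> 0"
    "\<And>i. i \<in> E \<Longrightarrow> (\<Sum>j\<in>U. M i j * a j) = 0" by blast
  define \<alpha> \<beta> where "\<alpha> k = a (Inl k)" and "\<beta> l = a (Inr l)" for k l
  define x where "x = (\<Sum>l<m. \<beta> l *\<^sub>C e l)"
  define y where "y = (\<Sum>k\<le>L. (of_real (sqrt (grid k)) * \<alpha> (Suc k)) *\<^sub>C f k)"
  have system: "(\<Sum>k\<le>Suc L. M i (Inl k) * \<alpha> k) + (\<Sum>l<m. M i (Inr l) * \<beta> l) = 0"
    if "i \<in> E" for i
    using a(2)[OF that] by (simp add: U_def sum.Plus \<alpha>_def \<beta>_def del: sum.atMost_Suc)
  have x: "cinner x (f k) = of_real (sqrt (1 - grid (k - 1))) * \<alpha> k" if "k \<le> L" for k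
  proof -
    have "(\<Sum>k'\<le>Suc L. M (Inl k) (Inl k') * \<alpha> k') =
        (\<Sum>k'\<le>Suc L. if k' = k then - of_real (sqrt (1 - grid (k - 1))) * \<alpha> k else 0)"
      by (rule sum.cong) (auto simp: M_def)
    then have "(\<Sum>k'\<le>Suc L. M (Inl k) (Inl k') * \<alpha> k') = - of_real (sqrt (1 - grid (k - 1))) * \<alpha> k"
      using that by (simp del: sum.atMost_Suc)
    moreover have "Inl k \<in> E" using that by (auto simp: E_def)
    ultimately show ?thesis
      using system[of "Inl k"]
      by (simp add: M_def x_def cinner_sum_left cinner_scaleC_left mult.commute del: sum.atMost_Suc)
  qed
  have y: "cinner y (e l) = 0" if "l < m" for l
  proof -
    have "(\<Sum>k\<le>Suc L. M (Inr l) (Inl k) * \<alpha> k) = cinner y (e l)"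
      \<comment> \<open>The split-off term at \<open>k = 0\<close> has weight
        \<open>sqrt (grid (0 - 1)) = 0\<close>, so \<open>\<alpha> 0\<close> does not enter
        \<open>y\<close>.\<close>
      unfolding sum.atMost_Suc_shift y_def cinner_sum_left cinner_scaleC_left
      by (simp add: M_def mult_ac)
    moreover have "Inr l \<in> E" using that by (auto simp: E_def)
    ultimately show ?thesis using system[of "Inr l"] by (simp add: M_def del: sum.atMost_Suc)
  qed
  define N where "N = (norm x)\<^sup>2 + (norm y)\<^sup>2"
  have "pauli_form S1 S2 S3 x y \<le> 0"
    unfolding x_def by (rule pauli_form_commuting_nonpos[OF S comm e nonneg y])
  moreover have "N / 2 \<le> pauli_form (planar 1) (planar \<i>) height x y"
    unfolding N_def by (rule pauli_form_ge[OF L x y_def])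
  moreover have "pauli_form (planar 1) (planar \<i>) height x y \<le> pauli_form S1 S2 S3 x y + 3 * (1/8) * N"
    unfolding N_def by (rule pauli_form_perturb[OF near])
  \<comment> \<open>The perturbation costs \<open>3/8 * N\<close>, less than the gap
    \<open>N / 2\<close>; this fixes the constant 1/8.\<close>
  ultimately have "(norm x)\<^sup>2 + (norm y)\<^sup>2 \<le> 0" unfolding N_def[symmetric] by simp
  then have zero: "x = 0" "y = 0" by (simp_all add: sum_power2_le_zero_iff)
  have \<beta>0: "\<beta> l = 0" if "l < m" for l
    using cinner_sum_orthonormal[OF orth, of "{..<m}" l \<beta>] that zero(1) by (simp add: x_def)
  have y0: "of_real (sqrt (grid k)) * \<alpha> (Suc k) = 0" if "k \<le> L" for k
    using cinner_sum_f[OF that, of "\<lambda>k. of_real (sqrt (grid k)) * \<alpha> (Suc k)"] zero(2) y_def by simp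
  \<comment> \<open>\<open>\<alpha> (Suc j)\<close> occurs in \<open>x\<close> with weight
    \<open>sqrt (1 - grid j)\<close> for \<open>j < L\<close> and in \<open>y\<close> with weight
    \<open>sqrt (grid j)\<close>. At the pole \<open>j = 0\<close> it is read off from
    \<open>x\<close>, otherwise from \<open>y\<close>.\<close>
  have \<alpha>0: "\<alpha> k = 0" if "k \<le> Suc L" for k
  proof (cases k)
    case 0
    then show ?thesis using x[of 0] zero(1) by simp
  next
    case (Suc j)
    show ?thesis
    proof (cases "grid j = 0")
      case True
      then have "j \<noteq> L" by auto
      then show ?thesis using x[of "Suc j"] zero(1) Suc that True by simp
    next
      case False
      then show ?thesis using y0[of j] Suc that by simp
    qed
  qed
  from a(1) \<alpha>0 \<beta>0 show False by (auto simp: U_def \<alpha>_def \<beta>_def)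
qed

section \<open>Choice of the sequence and the constant\<close>

theorem proposition6p4:
  assumes "separable_space (euclidean :: 'a::complex_hilbert_space topology)"
    and "infinite_dimensional TYPE('a)"
  shows "\<exists>(\<epsilon>\<^sub>0::real) (T :: nat \<Rightarrow> nat \<Rightarrow> 'a \<Rightarrow>\<^sub>L 'a).
    0 < \<epsilon>\<^sub>0 \<and> \<epsilon>\<^sub>0 < 1 \<and>
    (\<forall>n. \<forall>j\<in>{1..3}. self_adjoint (T n j) \<and> norm (T n j) \<le> 1) \<and>
    (\<forall>i\<in>{1..3}. \<forall>j\<in>{1..3}.
       (\<lambda>n. norm ((T n i o\<^sub>L T n j) - (T n j o\<^sub>L T n i))) \<longlonglongrightarrow> 0) \<and>
    (\<forall>n. \<forall>j\<in>{1..3}. pi_c (T n j) = \<one>\<^bsub>calkin_algebra\<^esub>) \<and>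
    Inf {Max ((\<lambda>j. norm (T n j - S j)) ` {1..3}) | (n::nat) (S :: nat \<Rightarrow> 'a \<Rightarrow>\<^sub>L 'a).
           (\<forall>j\<in>{1..3}. self_adjoint (S j)) \<and>
           (\<forall>i\<in>{1..3}. \<forall>j\<in>{1..3}. S i o\<^sub>L S j = S j o\<^sub>L S i)} \<ge> \<epsilon>\<^sub>0"
proof -
  obtain F :: "nat \<Rightarrow> nat \<Rightarrow> 'a" where F: "\<And>n. orthonormal_on {..<n} (F n)"
    using exists_orthonormal[OF assms(2)] by metis
  \<comment> \<open>The shift by 4 meets the requirement of \<open>pauli_form_ge\<close> for every
    \<open>n\<close>, and \<open>L n\<close> tends to infinity.\<close>
  define L :: "nat \<Rightarrow> nat" where "L n = n + 4" for n
  define f where "f n = F (Suc (L n))" for n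
  have chain: "orthonormal_chain (f n) (L n)" for n
  proof
    show "0 < L n" by (simp add: L_def)
    show "orthonormal_on {..L n} (f n)"
      using F[of "Suc (L n)"] by (simp add: f_def lessThan_Suc_atMost)
  qed
  define T where "T n j = (if j = 1 then orthonormal_chain.planar (f n) (L n) 1
    else if j = 2 then orthonormal_chain.planar (f n) (L n) \<i>
    else orthonormal_chain.height (f n) (L n))" for n and j :: nat
  have three: "{1..3} = {1, 2, 3::nat}" by auto
  have basic: "self_adjoint (T n j) \<and> norm (T n j) \<le> 1 \<and> pi_c (T n j) = \<one>\<^bsub>calkin_algebra\<^esub>" for n j
    using orthonormal_chain.self_adjoint_planar[OF chain] orthonormal_chain.self_adjoint_height[OF chain]
      orthonormal_chain.norm_planar_le[OF chain] orthonormal_chain.norm_height_le[OF chain]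
      orthonormal_chain.pi_c_planar[OF chain] orthonormal_chain.pi_c_height[OF chain]
    by (simp add: T_def)
  have comm: "norm ((T n i o\<^sub>L T n j) - (T n j o\<^sub>L T n i)) \<le> 2 / real (L n)"
    if "i \<in> {1..3}" "j \<in> {1..3}" for n i j
  proof -
    have "norm ((T n i o\<^sub>L T n j) - (T n j o\<^sub>L T n i)) \<le> 2 / real (L n)"
      if "(i, j) \<in> {(1, 2), (1, 3), (2, 3)}" for i j
      using that orthonormal_chain.norm_planar_commutator_le[OF chain, of n]
        orthonormal_chain.norm_planar_height_commutator_le[OF chain, of 1 n]
        orthonormal_chain.norm_planar_height_commutator_le[OF chain, of \<i> n]
      by (auto simp: T_def)
    from this[of i j] this[of j i] that show ?thesis
      unfolding three by (auto simp: norm_minus_commute)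
  qed
  have "(\<lambda>n. 2 / real (L n)) \<longlonglongrightarrow> 0"
    using LIMSEQ_ignore_initial_segment[OF lim_const_over_n[of "2::real"], of 4] by (simp add: L_def)
  then have lim: "(\<lambda>n. norm ((T n i o\<^sub>L T n j) - (T n j o\<^sub>L T n i))) \<longlonglongrightarrow> 0"
    if "i \<in> {1..3}" "j \<in> {1..3}" for i j
    by (rule Lim_null_comparison[rotated]) (simp add: comm[OF that])
  let ?dist = "{Max ((\<lambda>j. norm (T n j - S j)) ` {1..3}) | (n::nat) (S :: nat \<Rightarrow> 'a \<Rightarrow>\<^sub>L 'a).
           (\<forall>j\<in>{1..3}. self_adjoint (S j)) \<and>
           (\<forall>i\<in>{1..3}. \<forall>j\<in>{1..3}. S i o\<^sub>L S j = S j o\<^sub>L S i)}"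
  have far: "1/8 \<le> Inf ?dist"
  proof (rule cInf_greatest)
    \<comment> \<open>\<open>cInf_greatest\<close> needs a nonempty set: three copies of one
      self-adjoint operator commute.\<close>
    have "self_adjoint (T 0 0)" using basic by blast
    then show "?dist \<noteq> {}" by (auto intro!: exI[of _ "\<lambda>_. T 0 0"])
  next
    fix d assume "d \<in> ?dist"
    then obtain n and S :: "nat \<Rightarrow> 'a \<Rightarrow>\<^sub>L 'a" where
      d: "d = Max ((\<lambda>j. norm (T n j - S j)) ` {1..3})"
      and S: "\<forall>j\<in>{1..3}. self_adjoint (S j)" "\<forall>i\<in>{1..3}. \<forall>j\<in>{1..3}. S i o\<^sub>L S j = S j o\<^sub>L S i"
      by blast
    show "1/8 \<le> d"
    proof (rule ccontr)
      assume "\<not> 1/8 \<le> d"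
      moreover have "norm (T n j - S j) \<le> d" if "j \<in> {1..3}" for j
        unfolding d using that by (intro Max_ge) auto
      ultimately have near: "norm (T n j - S j) \<le> 1/8" if "j \<in> {1..3}" for j
        using that by force
      show False
        using orthonormal_chain_not_near_commuting[OF chain, of n "S 1" "S 2" "S 3"]
          S near[of 1] near[of 2] near[of 3]
        by (simp add: three T_def L_def)
    qed
  qed
  show ?thesis
    by (intro exI[of _ "1/8 :: real"] exI[of _ T]) (use basic lim far in auto)
qed

end
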